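(* Let $\mathbb{T}^4(\mathbb{R}^2)$ be the space of fourth-order tensors on $\mathbb{R}^2$ (no index symmetry), and write $\mathbf{T}=(\xi_1,\xi_2,\xi_3,\lambda_1,\lambda_2,\lambda_3,z_{2a},z_{2b},z_{2c},z_{2d},z_4)$ in a fixed explicit harmonic decomposition $\mathbb{T}^4(\mathbb{R}^2)\simeq3\mathbb{H}^{-1}(\mathbb{R}^2)\oplus3\mathbb{H}^0(\mathbb{R}^2)\oplus4\mathbb{H}^2(\mathbb{R}^2)\oplus\mathbb{H}^4(\mathbb{R}^2)$ under $\mathrm{O}(2)$ (under $\mathrm{SO}(2)$ this reads $6\mathbb{H}^0\oplus4\mathbb{H}^2\oplus\mathbb{H}^4$, with $\lambda_4=\xi_1,\lambda_5=\xi_2,\lambda_6=\xi_3$). Let $\mathcal{L}$ be the following list of $25$ monomials: order 0: $z_{2a}\overline{z}_{2b}$, $z_{2a}\overline{z}_{2c}$, $z_{2a}\overline{z}_{2d}$, $z_{2b}\overline{z}_{2c}$, $z_{2b}\overline{z}_{2d}$, $z_{2c}\overline{z}_{2d}$, $z_{2a}^2\overline{z}_4$, $z_{2b}^2\overline{z}_4$, $z_{2c}^2\overline{z}_4$, $z_{2d}^2\overline{z}_4$, $z_{2a}z_{2b}\overline{z}_4$, $z_{2a}z_{2c}\overline{z}_4$, $z_{2a}z_{2d}\overline{z}_4$, $z_{2b}z_{2c}\overline{z}_4$, $z_{2b}z_{2d}\overline{z}_4$, $z_{2c}z_{2d}\overline{z}_4$; order 2: $\overline{z}_{2a}z^2$,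 $\overline{z}_{2b}z^2$, $\overline{z}_{2c}z^2$, $\overline{z}_{2d}z^2$, $z_{2a}\overline{z}_4z^2$, $z_{2b}\overline{z}_4z^2$, $z_{2c}\overline{z}_4z^2$, $z_{2d}\overline{z}_4z^2$; order 4: $\overline{z}_4z^4$. Then: (1) a minimal integrity basis for $\mathrm{Cov}(\mathbb{T}^4(\mathbb{R}^2),\mathrm{SO}(2))$ consists of the $62$ covariants ($43$ of them invariants): $\lambda_1,\lambda_2,\lambda_3$, $\xi_1,\xi_2,\xi_3$, $z_{2a}\overline{z}_{2a}$, $z_{2b}\overline{z}_{2b}$, $z_{2c}\overline{z}_{2c}$, $z_{2d}\overline{z}_{2d}$, $z_4\overline{z}_4$, $z\overline{z}$, and $\mathrm{Re}(\mathbf{m})$, $\mathrm{Im}(\mathbf{m})$ for $\mathbf{m}\in\mathcal{L}$; (2) a minimal integrity basis for $\mathrm{Cov}(\mathbb{T}^4(\mathbb{R}^2),\mathrm{O}(2))$ consists of the $115$ covariants ($78$ of them invariants): $\lambda_1,\lambda_2,\lambda_3$, $z_{2a}\overline{z}_{2a}$, $z_{2b}\overline{z}_{2b}$, $z_{2c}\overline{z}_{2c}$, $z_{2d}\overline{z}_{2d}$, $z_4\overline{z}_4$, $z\overline{z}$, $\mathrm{Re}(\mathbf{m})$ for $\mathbf{m}\in\mathcal{L}$, the six products $\xi_1^2,\xi_2^2,\xi_3^2,\xi_1\xi_2,\xi_1\xi_3,\xi_2\xi_3$, and the products $\xi_i\,\mathrm{Im}(\mathbf{m})$ for $i\in\{1,2,3\}$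 and $\mathbf{m}\in\mathcal{L}$.
   Context: $\mathrm{O}(2)$ is generated by rotations $r_\theta$ and $\sigma=\mathrm{diag}(1,-1)$; it acts on $\mathbb{T}^n(\mathbb{R}^2)=\otimes^n\mathbb{R}^2$ by $(\rho(g)\mathbf{T})_{i_1\cdots i_n}=g_{i_1j_1}\cdots g_{i_nj_n}T_{j_1\cdots j_n}$. $\mathbb{H}^0=\mathbb{R}$ is the trivial representation (coordinates $\lambda_k$), $\mathbb{H}^{-1}=\mathbb{R}$ the sign representation $g\mapsto\det g$ (coordinates $\xi_i$); for $n\ge1$, $\mathbb{H}^n(\mathbb{R}^2)$ is the two-dimensional irreducible representation where $r_\theta$ acts as rotation of angle $n\theta$ and $\sigma$ as $\mathrm{diag}(1,-1)$. An explicit harmonic decomposition is a choice of $\mathrm{O}(2)$-equivariant linear isomorphism with the indicated direct sum; a component $(a,b)$ in a factor $\mathbb{H}^n$ is encoded by a complex coordinate $z_{n\ast}=a+ib$ (letters label multiplicities), so $r_\theta$ acts by $z_{n\ast}\mapsto e^{in\theta}z_{n\ast}$ and $\sigma$ by complex conjugation. $\mathrm{Inv}(\mathbb{V},G)$ is the algebra of $G$-invariant real polynomials on $\mathbb{V}$; $\mathrm{Cov}(\mathbb{V},G):=\mathrm{Inv}(\mathbb{V}\oplus\mathbb{R}^2,G)$, $G$ acting on $\mathbb{R}^2\ni\mathbf{x}=(x,y)$ in the standard way; $z=x+iy$. The order of a covariant is its degree in $\mathbf{x}$; invariants are covariants of order $0$. An integrity basis is a finite set of homogeneous generators of the algebra;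 it is minimal if no proper subset generates. *)

theory Defs
  imports "HOL-Analysis.Analysis" "HOL-Computational_Algebra.Polynomial"
begin

section \<open>Polynomial invariants, covariants and integrity bases\<close>

text \<open>Real polynomials on a finite-dimensional real vector space are identified with
  polynomial functions. A group is given as a set \<open>G\<close> of matrices together with its action.\<close>

definition Inv :: "'g set \<Rightarrow> ('g \<Rightarrow> 'v \<Rightarrow> 'v) \<Rightarrow> ('v::real_normed_vector \<Rightarrow> real) set" where
  "Inv G act = {f. real_polynomial_function f \<and> (\<forall>g\<in>G. \<forall>v. f (act g v) = f v)}"

definition Cov :: "(real^2^2) set \<Rightarrow> (real^2^2 \<Rightarrow> 'v \<Rightarrow> 'v)
    \<Rightarrow> ('v::real_normed_vector \<times> (real^2) \<Rightarrow> real) set" where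
  "Cov G act = Inv G (\<lambda>g (v, x). (act g v, g *v x))"

text \<open>The order of \<open>f\<close> is its degree in the second argument \<open>x\<close>, i.e. the largest degree in \<open>t\<close>
  of the one-variable polynomials \<open>f (v, t x)\<close>. (It is meaningful for polynomial functions.)\<close>

definition cov_order :: "('v \<times> (real^2) \<Rightarrow> real) \<Rightarrow> nat" where
  "cov_order f = (LEAST n. \<forall>v x. \<exists>p :: real poly. degree p \<le> n \<and> (\<forall>t. f (v, t *\<^sub>R x) = poly p t))"

inductive_set generated_algebra :: "('v \<Rightarrow> real) set \<Rightarrow> ('v \<Rightarrow> real) set"
  for B :: "('v \<Rightarrow> real) set" where
  const: "(\<lambda>_. c) \<in> generated_algebra B"
| gen: "f \<in> B \<Longrightarrow> f \<in> generated_algebra B"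
| add: "f \<in> generated_algebra B \<Longrightarrow> g \<in> generated_algebra B \<Longrightarrow> (\<lambda>v. f v + g v) \<in> generated_algebra B"
| mult: "f \<in> generated_algebra B \<Longrightarrow> g \<in> generated_algebra B \<Longrightarrow> (\<lambda>v. f v * g v) \<in> generated_algebra B"

definition homogeneous_function :: "('v::real_vector \<Rightarrow> real) \<Rightarrow> bool" where
  "homogeneous_function f \<longleftrightarrow> (\<exists>d::nat. \<forall>t v. f (t *\<^sub>R v) = t ^ d * f v)"

definition integrity_basis :: "('v::real_vector \<Rightarrow> real) set \<Rightarrow> ('v \<Rightarrow> real) set \<Rightarrow> bool" where
  "integrity_basis A B \<longleftrightarrow>
     finite B \<and> (\<forall>f\<in>B. homogeneous_function f) \<and> generated_algebra B = A"

definition minimal_integrity_basis :: "('v::real_vector \<Rightarrow> real) set \<Rightarrow> ('v \<Rightarrow> real) set \<Rightarrow> bool" where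
  "minimal_integrity_basis A B \<longleftrightarrow>
     integrity_basis A B \<and> (\<forall>C. C \<subset> B \<longrightarrow> generated_algebra C \<noteq> A)"


section \<open>Fourth-order tensors on the plane and their harmonic decompositions\<close>

type_synonym tensor4 = "real^2^2^2^2"

definition O2 :: "(real^2^2) set" where
  "O2 = {g. orthogonal_matrix g}"

definition SO2 :: "(real^2^2) set" where
  "SO2 = {g. rotation_matrix g}"

definition tensor_act :: "real^2^2 \<Rightarrow> tensor4 \<Rightarrow> tensor4" where
  "tensor_act g T = (\<chi> i j k l. \<Sum>p\<in>UNIV. \<Sum>q\<in>UNIV. \<Sum>r\<in>UNIV. \<Sum>s\<in>UNIV.
     g$i$p * g$j$q * g$k$r * g$l$s * T$p$q$r$s)"

text \<open>The two-dimensional representation \<open>H^n\<close> of \<open>O2\<close> on the complex plane. The first column of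
  \<open>g\<close> is \<open>(cos \<theta>, sin \<theta>)\<close> both for the rotation \<open>g = r\<^sub>\<theta>\<close> and for \<open>g = r\<^sub>\<theta> \<sigma>\<close>. The lemmas below
  say that this is the representation of \<open>O2\<close> in which \<open>r\<^sub>\<theta>\<close> acts as the rotation of angle \<open>n \<theta>\<close> and
  \<open>\<sigma>\<close> as complex conjugation.\<close>

definition harm_act :: "nat \<Rightarrow> real^2^2 \<Rightarrow> complex \<Rightarrow> complex" where
  "harm_act n g w = Complex (g$1$1) (g$2$1) ^ n * (if det g = 1 then w else cnj w)"

definition rot2 :: "real \<Rightarrow> real^2^2" where
  "rot2 \<theta> = vector [vector [cos \<theta>, - sin \<theta>], vector [sin \<theta>, cos \<theta>]]"

definition refl2 :: "real^2^2" where
  "refl2 = vector [vector [1, 0], vector [0, -1]]"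

lemma harm_act_rot2: "harm_act n (rot2 \<theta>) w = cis (n * \<theta>) * w"
proof -
  have "det (rot2 \<theta>) = 1"
    by (simp add: det_2 rot2_def flip: power2_eq_square)
  then show ?thesis
    by (simp add: harm_act_def rot2_def cis.code[symmetric] Complex.DeMoivre)
qed

lemma harm_act_refl2: "harm_act n refl2 w = cnj w"
  by (simp add: harm_act_def refl2_def det_2 flip: one_complex.code)

lemma O2_entries:
  assumes "g \<in> O2"
  shows "g$1$2 = - det g * g$2$1" "g$2$2 = det g * g$1$1"
    "g$1$1 * g$1$1 + g$2$1 * g$2$1 = 1" "det g = 1 \<or> det g = -1"
proof -
  have "transpose g ** g = mat 1" and det: "det g = 1 \<or> det g = -1"
    using assms det_orthogonal_matrix[of g] by (auto simp: O2_def orthogonal_matrix)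
  then have c: "g$1$1 * g$1$1 + g$2$1 * g$2$1 = 1" and o: "g$1$1 * g$1$2 + g$2$1 * g$2$2 = 0"
    by (auto simp: vec_eq_iff matrix_matrix_mult_def transpose_def mat_def sum_2 forall_2)
  from c o show "g$1$2 = - det g * g$2$1" "g$2$2 = det g * g$1$1"
    unfolding det_2 by algebra+
  show "g$1$1 * g$1$1 + g$2$1 * g$2$1 = 1" "det g = 1 \<or> det g = -1" by fact+
qed

lemma O2_cases:
  assumes "g \<in> O2"
  obtains \<theta> where "g = rot2 \<theta>" | \<theta> where "g = rot2 \<theta> ** refl2"
proof -
  obtain \<theta> where "g$1$1 = cos \<theta>" "g$2$1 = sin \<theta>"
    using O2_entries(3)[OF assms] sincos_total_2pi[of "g$1$1" "g$2$1"] by (auto simp: power2_eq_square)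
  then have "g = rot2 \<theta> \<or> g = rot2 \<theta> ** refl2"
    using O2_entries[OF assms]
    by (auto simp: vec_eq_iff forall_2 rot2_def refl2_def matrix_matrix_mult_def sum_2)
  then show thesis using that by blast
qed

lemma harm_act_mult:
  assumes "g \<in> O2" "h \<in> O2"
  shows "harm_act n (g ** h) w = harm_act n g (harm_act n h w)"
proof -
  have "Complex ((g ** h)$1$1) ((g ** h)$2$1) = harm_act 1 g (Complex (h$1$1) (h$2$1))"
    using O2_entries[OF assms(1)]
    by (auto simp: harm_act_def matrix_matrix_mult_def sum_2 complex_eq_iff)
  then show ?thesis
    using O2_entries(4)[OF assms(1)] O2_entries(4)[OF assms(2)]
    by (auto simp: harm_act_def det_mul power_mult_distrib)
qed

text \<open>\<open>3 H\<^sup>-\<^sup>1 + 3 H\<^sup>0 + 4 H\<^sup>2 + H\<^sup>4\<close>, with elements \<open>((\<xi>\<^sub>i)\<^sub>i, (\<lambda>\<^sub>k)\<^sub>k, z\<^sub>2\<^sub>a, z\<^sub>2\<^sub>b, z\<^sub>2\<^sub>c, z\<^sub>2\<^sub>d, z\<^sub>4)\<close>.\<close>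

type_synonym harm4 = "(real^3) \<times> (real^3) \<times> complex \<times> complex \<times> complex \<times> complex \<times> complex"

fun harm4_act :: "real^2^2 \<Rightarrow> harm4 \<Rightarrow> harm4" where
  "harm4_act g (\<xi>, l, a, b, c, d, w) =
     (det g *\<^sub>R \<xi>, l, harm_act 2 g a, harm_act 2 g b, harm_act 2 g c, harm_act 2 g d, harm_act 4 g w)"

definition harmonic_decomposition :: "(tensor4 \<Rightarrow> harm4) \<Rightarrow> bool" where
  "harmonic_decomposition \<Phi> \<longleftrightarrow> linear \<Phi> \<and> bij \<Phi> \<and>
     (\<forall>g\<in>O2. \<forall>T. \<Phi> (tensor_act g T) = harm4_act g (\<Phi> T))"

text \<open>Such a decomposition exists: contract the tensor with the four-fold tensor products of
  \<open>(1, i)\<close> and \<open>(1, -i)\<close>.\<close>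

definition contract4 :: "tensor4 \<Rightarrow> complex^2 \<Rightarrow> complex^2 \<Rightarrow> complex^2 \<Rightarrow> complex^2 \<Rightarrow> complex" where
  "contract4 T u1 u2 u3 u4 = (\<Sum>i\<in>UNIV. \<Sum>j\<in>UNIV. \<Sum>k\<in>UNIV. \<Sum>l\<in>UNIV.
     of_real (T$i$j$k$l) * u1$i * u2$j * u3$k * u4$l)"

definition harmonic_coords :: "tensor4 \<Rightarrow> harm4" where
  "harmonic_coords T = (let p = vector [1, \<i>]; m = vector [1, -\<i>] in
     (vector [Im (contract4 T p p m m), Im (contract4 T p m p m), Im (contract4 T p m m p)],
      vector [Re (contract4 T p p m m), Re (contract4 T p m p m), Re (contract4 T p m m p)],
      contract4 T m p p p, contract4 T p m p p, contract4 T p p m p, contract4 T p p p m,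
      contract4 T p p p p))"

lemma contract4_scale:
  "contract4 T (a *s u1) (b *s u2) (c *s u3) (d *s u4) = a * b * c * d * contract4 T u1 u2 u3 u4"
  by (simp add: contract4_def sum_2 algebra_simps)

lemma contract4_cnj:
  "contract4 T (\<chi> i. cnj (u1$i)) (\<chi> i. cnj (u2$i)) (\<chi> i. cnj (u3$i)) (\<chi> i. cnj (u4$i))
     = cnj (contract4 T u1 u2 u3 u4)"
  by (simp add: contract4_def)

lemma contract4_act:
  "contract4 (tensor_act g T) u1 u2 u3 u4 =
     contract4 T (\<chi> p. \<Sum>i\<in>UNIV. g$i$p * u1$i) (\<chi> p. \<Sum>i\<in>UNIV. g$i$p * u2$i)
       (\<chi> p. \<Sum>i\<in>UNIV. g$i$p * u3$i) (\<chi> p. \<Sum>i\<in>UNIV. g$i$p * u4$i)"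
  by (simp add: contract4_def tensor_act_def sum_2 algebra_simps)

lemma contract4_add: "contract4 (S + T) u1 u2 u3 u4 = contract4 S u1 u2 u3 u4 + contract4 T u1 u2 u3 u4"
  by (simp add: contract4_def distrib_right sum.distrib)

lemma contract4_scaleR: "contract4 (r *\<^sub>R T) u1 u2 u3 u4 = r *\<^sub>R contract4 T u1 u2 u3 u4"
  unfolding contract4_def scaleR_sum_right vector_scaleR_component
  by (simp add: scaleR_conv_of_real mult.assoc)

lemma linear_harmonic_coords: "linear harmonic_coords"
  by (rule linearI)
     (auto simp: harmonic_coords_def Let_def contract4_add contract4_scaleR vec_eq_iff forall_3)

lemma inj_harmonic_coords: "inj harmonic_coords"
proof (subst linear_injective_0[OF linear_harmonic_coords], intro allI impI)
  fix T assume "harmonic_coords T = 0"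
  then show "T = 0"
    by (simp add: harmonic_coords_def Let_def contract4_def zero_prod_def vec_eq_iff forall_3
        forall_2 sum_2 complex_eq_iff)
qed

lemma bij_harmonic_coords: "bij harmonic_coords"
proof -
  have "dim (range harmonic_coords) = DIM(tensor4)"
    using dim_image_eq[OF linear_harmonic_coords, of UNIV] inj_harmonic_coords
    by (simp only: span_UNIV dim_UNIV)
  moreover have "DIM(tensor4) = DIM(harm4)"
    by simp
  ultimately have "span (range harmonic_coords) = UNIV"
    by (metis dim_eq_full)
  moreover have "span (range harmonic_coords) = range harmonic_coords"
    using linear_subspace_image[OF linear_harmonic_coords subspace_UNIV] by (simp only: span_eq_iff)
  ultimately have "surj harmonic_coords"
    by simp
  with inj_harmonic_coords show ?thesis by (simp add: bij_def)
qed

lemma harmonic_decomposition_harmonic_coords: "harmonic_decomposition harmonic_coords"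
  unfolding harmonic_decomposition_def
proof (intro conjI ballI allI linear_harmonic_coords bij_harmonic_coords)
  fix g T assume g: "g \<in> O2"
  note e = O2_entries[OF g]
  define p m where "p = (vector [1, \<i>] :: complex^2)" and "m = (vector [1, -\<i>] :: complex^2)"
  define u where "u = Complex (g$1$1) (g$2$1)"
  have pm: "(\<chi> i. cnj (m$i)) = p" "(\<chi> i. cnj (p$i)) = m"
    by (simp_all add: p_def m_def vec_eq_iff forall_2)
  have uu: "u * cnj u = 1"
    using e(3) by (simp add: u_def complex_eq_iff)
  note cnj4 = contract4_cnj[of T p p m m, unfolded pm] contract4_cnj[of T p m p m, unfolded pm]
    contract4_cnj[of T p m m p, unfolded pm] contract4_cnj[of T m p p p, unfolded pm]
    contract4_cnj[of T p m p p, unfolded pm] contract4_cnj[of T p p m p, unfolded pm]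
    contract4_cnj[of T p p p m, unfolded pm] contract4_cnj[of T p p p p, unfolded pm]
  consider "det g = 1" | "det g = -1" using e(4) by blast
  then show "harmonic_coords (tensor_act g T) = harm4_act g (harmonic_coords T)"
  proof cases
    case 1
    have [simp]: "(\<chi> k. \<Sum>i\<in>UNIV. g$i$k * p$i) = u *s p" "(\<chi> k. \<Sum>i\<in>UNIV. g$i$k * m$i) = cnj u *s m"
      using e 1 by (simp_all add: u_def p_def m_def vec_eq_iff forall_2 sum_2 complex_eq_iff)
    have uu': "u * u * cnj u * cnj u = 1" "u * cnj u * u * cnj u = 1" "u * cnj u * cnj u * u = 1"
      "cnj u * u * u * u = u^2" "u * cnj u * u * u = u^2" "u * u * cnj u * u = u^2"
      "u * u * u * cnj u = u^2"
      using uu by algebra+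
    have u4: "u * u * u * u = u^4"
      by (simp only: power4_eq_xxxx)
    show ?thesis using 1
      by (simp add: harmonic_coords_def Let_def p_def[symmetric] m_def[symmetric] contract4_act
          contract4_scale harm_act_def u_def[symmetric] uu' u4)
  next
    case 2
    have [simp]: "(\<chi> k. \<Sum>i\<in>UNIV. g$i$k * p$i) = u *s m" "(\<chi> k. \<Sum>i\<in>UNIV. g$i$k * m$i) = cnj u *s p"
      using e 2 by (simp_all add: u_def p_def m_def vec_eq_iff forall_2 sum_2 complex_eq_iff)
    have uu': "u * u * cnj u * cnj u = 1" "u * cnj u * u * cnj u = 1" "u * cnj u * cnj u * u = 1"
      "cnj u * u * u * u = u^2" "u * cnj u * u * u = u^2" "u * u * cnj u * u = u^2"
      "u * u * u * cnj u = u^2"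
      using uu by algebra+
    have u4: "u * u * u * u = u^4"
      by (simp only: power4_eq_xxxx)
    show ?thesis using 2
      by (simp add: harmonic_coords_def Let_def p_def[symmetric] m_def[symmetric] contract4_act
          contract4_scale harm_act_def u_def[symmetric] uu' u4 cnj4 vec_eq_iff forall_3)
  qed
qed


section \<open>The generators\<close>

fun xi :: "3 \<Rightarrow> harm4 \<times> (real^2) \<Rightarrow> real" where "xi i ((\<xi>, l, a, b, c, d, w), x) = \<xi> $ i"
fun lam :: "3 \<Rightarrow> harm4 \<times> (real^2) \<Rightarrow> real" where "lam i ((\<xi>, l, a, b, c, d, w), x) = l $ i"
fun z2a :: "harm4 \<times> (real^2) \<Rightarrow> complex" where "z2a ((\<xi>, l, a, b, c, d, w), x) = a"
fun z2b :: "harm4 \<times> (real^2) \<Rightarrow> complex" where "z2b ((\<xi>, l, a, b, c, d, w), x) = b"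
fun z2c :: "harm4 \<times> (real^2) \<Rightarrow> complex" where "z2c ((\<xi>, l, a, b, c, d, w), x) = c"
fun z2d :: "harm4 \<times> (real^2) \<Rightarrow> complex" where "z2d ((\<xi>, l, a, b, c, d, w), x) = d"
fun z4 :: "harm4 \<times> (real^2) \<Rightarrow> complex" where "z4 ((\<xi>, l, a, b, c, d, w), x) = w"
fun zx :: "harm4 \<times> (real^2) \<Rightarrow> complex" where "zx (h, x) = Complex (x $ 1) (x $ 2)"

definition monomials :: "(harm4 \<times> (real^2) \<Rightarrow> complex) set" where
  "monomials = {
    \<comment> \<open>order 0\<close>
    \<lambda>v. z2a v * cnj (z2b v), \<lambda>v. z2a v * cnj (z2c v), \<lambda>v. z2a v * cnj (z2d v),
    \<lambda>v. z2b v * cnj (z2c v), \<lambda>v. z2b v * cnj (z2d v), \<lambda>v. z2c v * cnj (z2d v),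
    \<lambda>v. z2a v ^ 2 * cnj (z4 v), \<lambda>v. z2b v ^ 2 * cnj (z4 v),
    \<lambda>v. z2c v ^ 2 * cnj (z4 v), \<lambda>v. z2d v ^ 2 * cnj (z4 v),
    \<lambda>v. z2a v * z2b v * cnj (z4 v), \<lambda>v. z2a v * z2c v * cnj (z4 v), \<lambda>v. z2a v * z2d v * cnj (z4 v),
    \<lambda>v. z2b v * z2c v * cnj (z4 v), \<lambda>v. z2b v * z2d v * cnj (z4 v), \<lambda>v. z2c v * z2d v * cnj (z4 v),
    \<comment> \<open>order 2\<close>
    \<lambda>v. cnj (z2a v) * zx v ^ 2, \<lambda>v. cnj (z2b v) * zx v ^ 2,
    \<lambda>v. cnj (z2c v) * zx v ^ 2, \<lambda>v. cnj (z2d v) * zx v ^ 2,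
    \<lambda>v. z2a v * cnj (z4 v) * zx v ^ 2, \<lambda>v. z2b v * cnj (z4 v) * zx v ^ 2,
    \<lambda>v. z2c v * cnj (z4 v) * zx v ^ 2, \<lambda>v. z2d v * cnj (z4 v) * zx v ^ 2,
    \<comment> \<open>order 4\<close>
    \<lambda>v. cnj (z4 v) * zx v ^ 4}"

definition square_norms :: "(harm4 \<times> (real^2) \<Rightarrow> real) set" where
  "square_norms = {\<lambda>v. Re (z2a v * cnj (z2a v)), \<lambda>v. Re (z2b v * cnj (z2b v)),
     \<lambda>v. Re (z2c v * cnj (z2c v)), \<lambda>v. Re (z2d v * cnj (z2d v)),
     \<lambda>v. Re (z4 v * cnj (z4 v)), \<lambda>v. Re (zx v * cnj (zx v))}"

definition SO2_generators :: "(harm4 \<times> (real^2) \<Rightarrow> real) set" where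
  "SO2_generators = {lam 1, lam 2, lam 3} \<union> {xi 1, xi 2, xi 3} \<union> square_norms \<union>
     {\<lambda>v. Re (m v) | m. m \<in> monomials} \<union> {\<lambda>v. Im (m v) | m. m \<in> monomials}"

definition O2_generators :: "(harm4 \<times> (real^2) \<Rightarrow> real) set" where
  "O2_generators = {lam 1, lam 2, lam 3} \<union> square_norms \<union>
     {\<lambda>v. Re (m v) | m. m \<in> monomials} \<union>
     {\<lambda>v. xi 1 v ^ 2, \<lambda>v. xi 2 v ^ 2, \<lambda>v. xi 3 v ^ 2,
      \<lambda>v. xi 1 v * xi 2 v, \<lambda>v. xi 1 v * xi 3 v, \<lambda>v. xi 2 v * xi 3 v} \<union>
     {\<lambda>v. xi i v * Im (m v) | i m. i \<in> {1, 2, 3} \<and> m \<in> monomials}"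

text \<open>Functions of the harmonic coordinates, read as functions of the tensor itself.\<close>

definition in_coords :: "(tensor4 \<Rightarrow> harm4) \<Rightarrow> (harm4 \<times> (real^2) \<Rightarrow> real) set
    \<Rightarrow> (tensor4 \<times> (real^2) \<Rightarrow> real) set" where
  "in_coords \<Phi> B = (\<lambda>f (T, x). f (\<Phi> T, x)) ` B"

end

theory Submission
  imports Defs
begin

text \<open>Everything takes place in harmonic coordinates, where a rotation of angle \<open>\<theta>\<close> multiplies
  \<open>z\<close>, \<open>z\<^sub>2\<^sub>*\<close> and \<open>z\<^sub>4\<close> by \<open>exp (i \<theta>)\<close>, \<open>exp (2 i \<theta>)\<close> and \<open>exp (4 i \<theta>)\<close> and fixes the \<open>\<xi>\<^sub>i\<close> and
  \<open>\<lambda>\<^sub>k\<close>. With \<open>z\<^sup>2\<close> as a fifth companion of the four \<open>z\<^sub>2\<^sub>*\<close>, the \<open>25\<close> monomials are the products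
  \<open>p cnj q\<close> of two distinct vectors and the products \<open>p q cnj z\<^sub>4\<close> of two arbitrary ones.

  Generation, \<open>SO(2)\<close> (\<open>Inv_SO2\<close>). A polynomial is a sum of monomials in the coordinates and their
  conjugates, and a monomial has a charge \<open>c\<close>: the rotation of angle \<open>\<theta>\<close> multiplies it by
  \<open>exp (i c \<theta>)\<close>. Averaging over the rotations of angle \<open>2 \<pi> k / N\<close>, with \<open>N\<close> larger than all the
  charges, fixes an invariant polynomial and deletes every monomial of charge \<open>\<noteq> 0\<close>
  (\<open>mixed_average\<close>). A monomial of charge \<open>0\<close> is a product of generators, found by splitting
  off one small neutral factor after the other (\<open>power_product_balanced\<close>).

  Generation, \<open>O(2)\<close> (\<open>Inv_O2\<close>). Let \<open>B\<close> be the algebra that the \<open>115\<close> functions generate. The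
  \<open>\<xi>\<^sub>i\<close> and the \<open>Im m\<close> are the \<open>SO(2)\<close> generators that change sign under the reflection, and the
  product of any two of them lies in \<open>B\<close>. This is clear except for \<open>Im m Im m'\<close>. There one writes
  each \<open>m\<close> as \<open>X cnj Y\<close> with \<open>X\<close> and \<open>Y\<close> among the ten functions \<open>p\<close> and \<open>z\<^sub>4 cnj p\<close>, which all have
  charge \<open>2\<close>, so that \<open>Im m\<close> is an area and the product of two areas is a Gram determinant of
  inner products \<open>Re (X cnj Y)\<close>, which lie in \<open>B\<close> (\<open>odd_part_square\<close>). Hence every \<open>SO(2)\<close> invariant
  is \<open>e + h\<close> with \<open>e\<close> in \<open>B\<close> and \<open>h\<close> odd, and invariance under the reflection forces \<open>h = 0\<close>.

  Minimality (\<open>SO2_irreducible\<close>, \<open>O2_irreducible\<close>). Each generator is homogeneous for every choice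
  of weights of the coordinates. Along a curve \<open>t \<mapsto> (t^weight * coordinate)\<close> it becomes a
  monomial in \<open>t\<close>, and the algebra generated by the other generators becomes a set of polynomials
  whose exponents lie in the monoid spanned by the weights of those that do not vanish on the
  curve. For each generator there are weights and a point such that its own weight is outside
  that monoid. This also shows that the generators are pairwise distinct, which gives the
  cardinalities.\<close>

section \<open>Generated algebras\<close>

lemma generated_algebra_mono:
  assumes "B \<subseteq> generated_algebra C" "f \<in> generated_algebra B"
  shows "f \<in> generated_algebra C"
  using assms(2)
  by (induction rule: generated_algebra.induct)
     (use assms(1) in \<open>auto intro: generated_algebra.intros\<close>)

lemma generated_algebra_cmult:
  "f \<in> generated_algebra B \<Longrightarrow> (\<lambda>v. c * f v) \<in> generated_algebra B"
  by (rule generated_algebra.mult[OF generated_algebra.const])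

lemma generated_algebra_minus:
  "f \<in> generated_algebra B \<Longrightarrow> (\<lambda>v. - f v) \<in> generated_algebra B"
  using generated_algebra_cmult[of f B "-1"] by simp

lemma generated_algebra_diff:
  "f \<in> generated_algebra B \<Longrightarrow> g \<in> generated_algebra B \<Longrightarrow> (\<lambda>v. f v - g v) \<in> generated_algebra B"
  using generated_algebra.add[OF _ generated_algebra_minus] by simp

lemmas generated_algebra_closed =
  generated_algebra.const generated_algebra.add generated_algebra.mult
  generated_algebra_minus generated_algebra_diff

text \<open>Used to pass from harmonic coordinates to tensors.\<close>

lemma generated_algebra_image_comp:
  "generated_algebra ((\<lambda>f. f \<circ> h) ` B) = (\<lambda>f. f \<circ> h) ` generated_algebra B"
proof (intro equalityI subsetI)
  fix f assume "f \<in> generated_algebra ((\<lambda>f. f \<circ> h) ` B)"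
  then show "f \<in> (\<lambda>f. f \<circ> h) ` generated_algebra B"
  proof (induction rule: generated_algebra.induct)
    case (const c)
    show ?case by (rule image_eqI[of _ _ "\<lambda>_. c"]) (auto intro: generated_algebra.const)
  next
    case (gen f)
    then show ?case by (auto intro: generated_algebra.gen)
  next
    case (add f g)
    then obtain f' g' where "f' \<in> generated_algebra B" "g' \<in> generated_algebra B"
      "f = f' \<circ> h" "g = g' \<circ> h" by blast
    then show ?case
      by (intro image_eqI[of _ _ "\<lambda>v. f' v + g' v"]) (auto intro: generated_algebra.add)
  next
    case (mult f g)
    then obtain f' g' where "f' \<in> generated_algebra B" "g' \<in> generated_algebra B"
      "f = f' \<circ> h" "g = g' \<circ> h" by blast
    then show ?case
      by (intro image_eqI[of _ _ "\<lambda>v. f' v * g' v"]) (auto intro: generated_algebra.mult)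
  qed
next
  fix f assume "f \<in> (\<lambda>f. f \<circ> h) ` generated_algebra B"
  then obtain f' where "f' \<in> generated_algebra B" "f = f' \<circ> h" by auto
  from this(1) have "f' \<circ> h \<in> generated_algebra ((\<lambda>f. f \<circ> h) ` B)"
    by (induction rule: generated_algebra.induct) (auto intro: generated_algebra.intros simp: o_def)
  with \<open>f = f' \<circ> h\<close> show "f \<in> generated_algebra ((\<lambda>f. f \<circ> h) ` B)" by simp
qed

text \<open>The functions that restrict on the curve \<open>\<gamma>\<close> to a polynomial with exponents in the monoid
  \<open>S\<close> form an algebra. It contains \<open>B\<close> and misses \<open>f\<close>.\<close>

lemma not_generated_along_curve:
  fixes f :: "'v \<Rightarrow> real" and \<gamma> :: "real \<Rightarrow> 'v" and S :: "nat set"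
  assumes S: "0 \<in> S" "\<And>i j. i \<in> S \<Longrightarrow> j \<in> S \<Longrightarrow> i + j \<in> S"
    and B: "\<And>g. g \<in> B \<Longrightarrow> \<exists>c n. (c = 0 \<or> n \<in> S) \<and> (\<forall>t. g (\<gamma> t) = c * t ^ n)"
    and f: "\<And>t. f (\<gamma> t) = c * t ^ k" "c \<noteq> 0" "k \<notin> S"
  shows "f \<notin> generated_algebra B"
proof
  have *: "\<exists>p :: real poly. (\<forall>t. g (\<gamma> t) = poly p t) \<and> (\<forall>n. n \<notin> S \<longrightarrow> coeff p n = 0)"
    if "g \<in> generated_algebra B" for g
    using that
  proof (induction rule: generated_algebra.induct)
    case (const c)
    show ?case using S(1) by (intro exI[of _ "[:c:]"]) (auto simp: coeff_pCons split: nat.split)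
  next
    case (gen g)
    from B[OF this] obtain c n where "c = 0 \<or> n \<in> S" "\<forall>t. g (\<gamma> t) = c * t ^ n" by blast
    then show ?case by (intro exI[of _ "monom c n"]) (auto simp: poly_monom)
  next
    case (add g h)
    then obtain p q where "\<forall>t. g (\<gamma> t) = poly p t" "\<forall>n. n \<notin> S \<longrightarrow> coeff p n = 0"
      "\<forall>t. h (\<gamma> t) = poly q t" "\<forall>n. n \<notin> S \<longrightarrow> coeff q n = 0" by blast
    then show ?case by (intro exI[of _ "p + q"]) auto
  next
    case (mult g h)
    then obtain p q where pq: "\<forall>t. g (\<gamma> t) = poly p t" "\<forall>n. n \<notin> S \<longrightarrow> coeff p n = 0"
      "\<forall>t. h (\<gamma> t) = poly q t" "\<forall>n. n \<notin> S \<longrightarrow> coeff q n = 0" by blast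
    have "coeff (p * q) n = 0" if "n \<notin> S" for n
      unfolding coeff_mult
    proof (intro sum.neutral ballI)
      fix i assume "i \<in> {..n}"
      then have "i \<notin> S \<or> n - i \<notin> S" using S(2)[of i "n - i"] that by auto
      then show "coeff p i * coeff q (n - i) = 0" using pq by auto
    qed
    with pq show ?case by (intro exI[of _ "p * q"]) auto
  qed
  assume "f \<in> generated_algebra B"
  from *[OF this] obtain p :: "real poly"
    where p: "\<And>t. f (\<gamma> t) = poly p t" "\<And>n. n \<notin> S \<Longrightarrow> coeff p n = 0" by blast
  have "poly p = poly (monom c k)" using f(1) p(1) by (auto simp: poly_monom)
  then have "p = monom c k" by (simp add: poly_eq_poly_eq_iff)
  with p(2)[OF f(3)] f(2) show False by simp
qed


section \<open>An indexing of the generators\<close>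

type_synonym pt = "harm4 \<times> (real^2)"

datatype letter = La | Lb | Lc | Ld | Lz

fun coord :: "letter \<Rightarrow> pt \<Rightarrow> complex" where
  "coord La = z2a" | "coord Lb = z2b" | "coord Lc = z2c" | "coord Ld = z2d" | "coord Lz = zx"

text \<open>The five functions on which a rotation of angle \<open>\<theta>\<close> acts by \<open>exp (2 i \<theta>)\<close>.\<close>

definition vec2 :: "letter \<Rightarrow> pt \<Rightarrow> complex" where
  "vec2 p v = (if p = Lz then coord p v ^ 2 else coord p v)"

datatype mono_index = Quad letter letter | Cubic letter letter

fun mon :: "mono_index \<Rightarrow> pt \<Rightarrow> complex" where
  "mon (Quad p q) v = vec2 p v * cnj (vec2 q v)"
| "mon (Cubic p q) v = vec2 p v * vec2 q v * cnj (z4 v)"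

lemma mon_fun:
  "mon (Quad p q) = (\<lambda>v. vec2 p v * cnj (vec2 q v))"
  "mon (Cubic p q) = (\<lambda>v. vec2 p v * vec2 q v * cnj (z4 v))"
  by (simp_all add: fun_eq_iff)

text \<open>\<open>Lz\<close> comes first so that the order of the two factors in \<open>cnj z\<^sub>2\<^sub>a z\<^sup>2\<close>, where \<open>z\<^sup>2\<close> is the factor
  without conjugation, agrees with that in \<open>z\<^sub>2\<^sub>a cnj z\<^sub>2\<^sub>b\<close>.\<close>

fun pos :: "letter \<Rightarrow> nat" where
  "pos Lz = 0" | "pos La = 1" | "pos Lb = 2" | "pos Lc = 3" | "pos Ld = 4"

lemma pos_eq_iff: "pos p = pos q \<longleftrightarrow> p = q"
  by (cases p; cases q) auto

fun listed :: "mono_index \<Rightarrow> bool" where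
  "listed (Quad p q) \<longleftrightarrow> pos p < pos q"
| "listed (Cubic p q) \<longleftrightarrow> pos p \<le> pos q"

lemma UNIV_letter: "UNIV = {La, Lb, Lc, Ld, Lz}"
  using letter.exhaust by blast

lemma Collect_listed: "Collect listed =
  {Quad La Lb, Quad La Lc, Quad La Ld, Quad Lb Lc, Quad Lb Ld, Quad Lc Ld,
   Cubic La La, Cubic Lb Lb, Cubic Lc Lc, Cubic Ld Ld,
   Cubic La Lb, Cubic La Lc, Cubic La Ld, Cubic Lb Lc, Cubic Lb Ld, Cubic Lc Ld,
   Quad Lz La, Quad Lz Lb, Quad Lz Lc, Quad Lz Ld,
   Cubic Lz La, Cubic Lz Lb, Cubic Lz Lc, Cubic Lz Ld, Cubic Lz Lz}" (is "_ = ?R")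
proof (intro equalityI subsetI)
  fix m assume "m \<in> Collect listed"
  then show "m \<in> ?R"
  proof (cases m)
    case (Quad p q)
    then show ?thesis using \<open>m \<in> _\<close> by (cases p; cases q) simp_all
  next
    case (Cubic p q)
    then show ?thesis using \<open>m \<in> _\<close> by (cases p; cases q) simp_all
  qed
qed auto

lemma monomials_eq: "monomials = mon ` Collect listed"
proof -
  have Lz: "mon (Cubic Lz Lz) = (\<lambda>v. cnj (z4 v) * zx v ^ 4)"
    by (simp add: fun_eq_iff vec2_def)
  have same: "mon (Cubic p p) = (\<lambda>v. coord p v ^ 2 * cnj (z4 v))"
    and order2: "mon (Quad Lz p) = (\<lambda>v. cnj (coord p v) * zx v ^ 2)"
      "mon (Cubic Lz p) = (\<lambda>v. coord p v * cnj (z4 v) * zx v ^ 2)" if "p \<noteq> Lz" for p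
    using that by (simp_all add: fun_eq_iff vec2_def power2_eq_square)
  have order0: "mon (Quad p q) = (\<lambda>v. coord p v * cnj (coord q v))"
    "mon (Cubic p q) = (\<lambda>v. coord p v * coord q v * cnj (z4 v))" if "p \<noteq> Lz" "q \<noteq> Lz" for p q
    using that by (simp_all add: fun_eq_iff vec2_def)
  show ?thesis
    unfolding Collect_listed monomials_def image_insert image_empty Lz
    by (simp only: same order2 letter.distinct not_False_eq_True coord.simps)
       (simp only: order0 letter.distinct not_False_eq_True coord.simps)
qed

text \<open>A single type of names for the generators of both groups. Minimality and distinctness become
  statements about the family \<open>gen\<close>.\<close>

datatype index = Lam 3 | Xi 3 | Norm letter | NormW | ReM mono_index | ImM mono_index
  | XiXi 3 3 | XiIm 3 mono_index

fun gen :: "index \<Rightarrow> pt \<Rightarrow> real" where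
  "gen (Lam k) v = lam k v"
| "gen (Xi i) v = xi i v"
| "gen (Norm p) v = Re (coord p v * cnj (coord p v))"
| "gen NormW v = Re (z4 v * cnj (z4 v))"
| "gen (ReM m) v = Re (mon m v)"
| "gen (ImM m) v = Im (mon m v)"
| "gen (XiXi i j) v = xi i v * xi j v"
| "gen (XiIm i m) v = xi i v * Im (mon m v)"

lemma gen_fun:
  "gen (Lam k) = lam k" "gen (Xi i) = xi i"
  "gen (Norm p) = (\<lambda>v. Re (coord p v * cnj (coord p v)))"
  "gen NormW = (\<lambda>v. Re (z4 v * cnj (z4 v)))"
  "gen (ReM m) = (\<lambda>v. Re (mon m v))" "gen (ImM m) = (\<lambda>v. Im (mon m v))"
  "gen (XiXi i j) = (\<lambda>v. xi i v * xi j v)" "gen (XiIm i m) = (\<lambda>v. xi i v * Im (mon m v))"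
  by (simp_all add: fun_eq_iff)

definition xi_pairs :: "(3 \<times> 3) set" where
  "xi_pairs = {(1,1), (2,2), (3,3), (1,2), (1,3), (2,3)}"

definition common_index :: "index set" where
  "common_index = range Lam \<union> range Norm \<union> {NormW} \<union> ReM ` Collect listed"

definition SO2_index :: "index set" where
  "SO2_index = common_index \<union> range Xi \<union> ImM ` Collect listed"

definition O2_index :: "index set" where
  "O2_index = common_index \<union> case_prod XiXi ` xi_pairs \<union> case_prod XiIm ` (UNIV \<times> Collect listed)"

lemma gen_common: "gen ` common_index =
  {lam 1, lam 2, lam 3} \<union> square_norms \<union> {\<lambda>v. Re (m v) | m. m \<in> monomials}"
proof -
  have Lam: "gen ` range Lam = {lam 1, lam 2, lam 3}"
    by (simp add: UNIV_3 gen_fun)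
  have Norm: "gen ` (range Norm \<union> {NormW}) = square_norms"
    by (simp add: UNIV_letter square_norms_def insert_commute gen_fun)
  have Re: "gen ` ReM ` Collect listed = {\<lambda>v. Re (m v) | m. m \<in> monomials}"
    unfolding monomials_eq by (auto simp: image_image gen_fun)
  show ?thesis
    unfolding common_index_def image_Un Lam[symmetric] Norm[symmetric] Re[symmetric] by blast
qed

lemma SO2_generators_eq: "SO2_generators = gen ` SO2_index"
proof -
  have Xi: "gen ` range Xi = {xi 1, xi 2, xi 3}"
    by (simp add: UNIV_3 gen_fun)
  have Im: "gen ` ImM ` Collect listed = {\<lambda>v. Im (m v) | m. m \<in> monomials}"
    unfolding monomials_eq by (auto simp: image_image gen_fun)
  show ?thesis unfolding SO2_index_def SO2_generators_def image_Un gen_common Xi Im by blast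
qed

lemma O2_generators_eq: "O2_generators = gen ` O2_index"
proof -
  have XiXi: "gen ` case_prod XiXi ` xi_pairs =
      {\<lambda>v. xi 1 v ^ 2, \<lambda>v. xi 2 v ^ 2, \<lambda>v. xi 3 v ^ 2,
       \<lambda>v. xi 1 v * xi 2 v, \<lambda>v. xi 1 v * xi 3 v, \<lambda>v. xi 2 v * xi 3 v}"
    by (simp add: xi_pairs_def power2_eq_square gen_fun)
  have XiIm: "gen ` case_prod XiIm ` (UNIV \<times> Collect listed) =
      {\<lambda>v. xi i v * Im (m v) | i m. i \<in> {1, 2, 3} \<and> m \<in> monomials}"
  proof -
    have "gen ` case_prod XiIm ` (UNIV \<times> Collect listed) =
        (\<lambda>(i, m). \<lambda>v. xi i v * Im (mon m v)) ` ({1, 2, 3} \<times> Collect listed)"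
      by (simp add: image_image case_prod_beta UNIV_3 gen_fun)
    also have "\<dots> = {\<lambda>v. xi i v * Im (m v) | i m. i \<in> {1, 2, 3} \<and> m \<in> monomials}"
      unfolding monomials_eq by (auto 0 4 simp: image_iff)
    finally show ?thesis .
  qed
  show ?thesis unfolding O2_index_def O2_generators_def image_Un gen_common XiXi XiIm by blast
qed


section \<open>Weighted scalings\<close>

text \<open>The weights are left free because three choices matter: all weights \<open>1\<close> gives homogeneity,
  weight \<open>1\<close> on \<open>x\<close> alone gives the order of a covariant, and special weights separate a generator
  from the others.\<close>

fun wscale :: "(3 \<Rightarrow> nat) \<Rightarrow> nat \<Rightarrow> (letter \<Rightarrow> nat) \<Rightarrow> nat \<Rightarrow> real \<Rightarrow> pt \<Rightarrow> pt" where
  "wscale \<kappa> \<nu> e \<omega> t ((\<xi>, l, a, b, c, d, w), x) =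
     ((\<chi> i. t ^ \<kappa> i * \<xi> $ i, t ^ \<nu> *\<^sub>R l, t ^ e La *\<^sub>R a, t ^ e Lb *\<^sub>R b, t ^ e Lc *\<^sub>R c,
       t ^ e Ld *\<^sub>R d, t ^ \<omega> *\<^sub>R w), t ^ e Lz *\<^sub>R x)"

lemma wscale_coords:
  "xi i (wscale \<kappa> \<nu> e \<omega> t v) = t ^ \<kappa> i * xi i v"
  "lam i (wscale \<kappa> \<nu> e \<omega> t v) = t ^ \<nu> * lam i v"
  "coord p (wscale \<kappa> \<nu> e \<omega> t v) = t ^ e p *\<^sub>R coord p v"
  "z4 (wscale \<kappa> \<nu> e \<omega> t v) = t ^ \<omega> *\<^sub>R z4 v"
proof -
  obtain \<xi> l a b c d w x where v: "v = ((\<xi>, l, a, b, c, d, w), x)" by (metis prod.exhaust)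
  show "xi i (wscale \<kappa> \<nu> e \<omega> t v) = t ^ \<kappa> i * xi i v"
    "lam i (wscale \<kappa> \<nu> e \<omega> t v) = t ^ \<nu> * lam i v"
    "z4 (wscale \<kappa> \<nu> e \<omega> t v) = t ^ \<omega> *\<^sub>R z4 v"
    by (simp_all add: v)
  show "coord p (wscale \<kappa> \<nu> e \<omega> t v) = t ^ e p *\<^sub>R coord p v"
    by (cases p) (simp_all add: v complex_eq_iff)
qed

definition vec2_weight :: "(letter \<Rightarrow> nat) \<Rightarrow> letter \<Rightarrow> nat" where
  "vec2_weight e p = (if p = Lz then 2 * e p else e p)"

lemma vec2_wscale: "vec2 p (wscale \<kappa> \<nu> e \<omega> t v) = t ^ vec2_weight e p *\<^sub>R vec2 p v"
  by (simp add: vec2_def vec2_weight_def wscale_coords power_mult_distrib scaleR_conv_of_real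
      power_mult mult.commute[of 2] del: coord.simps)

fun mon_weight :: "(letter \<Rightarrow> nat) \<Rightarrow> nat \<Rightarrow> mono_index \<Rightarrow> nat" where
  "mon_weight e \<omega> (Quad p q) = vec2_weight e p + vec2_weight e q"
| "mon_weight e \<omega> (Cubic p q) = vec2_weight e p + vec2_weight e q + \<omega>"

lemma mon_wscale: "mon m (wscale \<kappa> \<nu> e \<omega> t v) = t ^ mon_weight e \<omega> m *\<^sub>R mon m v"
  by (cases m) (simp_all add: vec2_wscale wscale_coords power_add scaleR_conv_of_real)

fun weight :: "(3 \<Rightarrow> nat) \<Rightarrow> nat \<Rightarrow> (letter \<Rightarrow> nat) \<Rightarrow> nat \<Rightarrow> index \<Rightarrow> nat" where
  "weight \<kappa> \<nu> e \<omega> (Lam k) = \<nu>"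
| "weight \<kappa> \<nu> e \<omega> (Xi i) = \<kappa> i"
| "weight \<kappa> \<nu> e \<omega> (Norm p) = 2 * e p"
| "weight \<kappa> \<nu> e \<omega> NormW = 2 * \<omega>"
| "weight \<kappa> \<nu> e \<omega> (ReM m) = mon_weight e \<omega> m"
| "weight \<kappa> \<nu> e \<omega> (ImM m) = mon_weight e \<omega> m"
| "weight \<kappa> \<nu> e \<omega> (XiXi i j) = \<kappa> i + \<kappa> j"
| "weight \<kappa> \<nu> e \<omega> (XiIm i m) = \<kappa> i + mon_weight e \<omega> m"

lemma gen_wscale: "gen j (wscale \<kappa> \<nu> e \<omega> t v) = t ^ weight \<kappa> \<nu> e \<omega> j * gen j v"
proof (cases j)
  case (Norm p)
  then show ?thesis
    by (simp add: wscale_coords power_mult power2_eq_square power_mult_distrib algebra_simps)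
next
  case NormW
  then show ?thesis
    by (simp add: wscale_coords power_mult power2_eq_square power_mult_distrib algebra_simps)
qed (simp_all add: wscale_coords mon_wscale power_add)

lemma wscale_uniform: "wscale (\<lambda>_. 1) 1 (\<lambda>_. 1) 1 t v = t *\<^sub>R v"
proof -
  obtain \<xi> l a b c d w x where "v = ((\<xi>, l, a, b, c, d, w), x)" by (metis prod.exhaust)
  then show ?thesis by (simp add: vec_eq_iff)
qed

lemma wscale_x: "wscale (\<lambda>_. 0) 0 (\<lambda>p. if p = Lz then 1 else 0) 0 t (h, x) = (h, t *\<^sub>R x)"
  by (cases h) (auto simp: vec_eq_iff)


section \<open>Minimality\<close>

lemma not_generated_by_weights:
  assumes S: "0 \<in> S" "\<And>i j. i \<in> S \<Longrightarrow> j \<in> S \<Longrightarrow> i + j \<in> S"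
    and others: "\<forall>j\<in>J. j \<noteq> k \<longrightarrow> gen j v = 0 \<or> weight \<kappa> \<nu> e \<omega> j \<in> S"
    and target: "gen k v \<noteq> 0" "weight \<kappa> \<nu> e \<omega> k \<notin> S"
  shows "gen k \<notin> generated_algebra (gen ` (J - {k}))"
proof (rule not_generated_along_curve[where \<gamma> = "\<lambda>t. wscale \<kappa> \<nu> e \<omega> t v" and S = S])
  show "\<exists>c n. (c = 0 \<or> n \<in> S) \<and> (\<forall>t. g (wscale \<kappa> \<nu> e \<omega> t v) = c * t ^ n)"
    if "g \<in> gen ` (J - {k})" for g
    using that others
  proof -
    from that obtain j where "g = gen j" "j \<in> J" "j \<noteq> k" by auto
    with others show ?thesis
      by (intro exI[of _ "gen j v"] exI[of _ "weight \<kappa> \<nu> e \<omega> j"]) (simp add: gen_wscale)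
  qed
  show "gen k (wscale \<kappa> \<nu> e \<omega> t v) = gen k v * t ^ weight \<kappa> \<nu> e \<omega> k" for t
    by (simp add: gen_wscale)
qed (use S target in auto)

lemma all_listed: "(\<forall>m. listed m \<longrightarrow> P m) \<longleftrightarrow>
  (\<forall>p q. pos p < pos q \<longrightarrow> P (Quad p q)) \<and> (\<forall>p q. pos p \<le> pos q \<longrightarrow> P (Cubic p q))"
  by (metis listed.simps mono_index.exhaust)

lemma ball_SO2_index: "(\<forall>j\<in>SO2_index. P j) \<longleftrightarrow>
  (\<forall>i. P (Lam i)) \<and> (\<forall>i. P (Xi i)) \<and> (\<forall>p. P (Norm p)) \<and> P NormW \<and>
  (\<forall>m. listed m \<longrightarrow> P (ReM m) \<and> P (ImM m))"
  by (auto simp: SO2_index_def common_index_def)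

lemma ball_O2_index: "(\<forall>j\<in>O2_index. P j) \<longleftrightarrow>
  (\<forall>i. P (Lam i)) \<and> (\<forall>(i, j)\<in>xi_pairs. P (XiXi i j)) \<and> (\<forall>p. P (Norm p)) \<and> P NormW \<and>
  (\<forall>m. listed m \<longrightarrow> P (ReM m) \<and> (\<forall>i. P (XiIm i m)))"
  by (simp add: O2_index_def common_index_def ball_Un case_prod_beta) blast

text \<open>The point with prescribed coordinates; \<open>y Lz\<close> is the value of \<open>z\<close>, not of \<open>z\<^sup>2\<close>.\<close>

definition point :: "(3 \<Rightarrow> real) \<Rightarrow> (3 \<Rightarrow> real) \<Rightarrow> (letter \<Rightarrow> complex) \<Rightarrow> complex \<Rightarrow> pt" where
  "point \<xi> l y w = ((\<chi> i. \<xi> i, \<chi> i. l i, y La, y Lb, y Lc, y Ld, w), vector [Re (y Lz), Im (y Lz)])"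

lemma point_coords [simp]:
  "xi i (point \<xi> l y w) = \<xi> i" "lam i (point \<xi> l y w) = l i" "coord p (point \<xi> l y w) = y p"
  "z4 (point \<xi> l y w) = w" "vec2 p (point \<xi> l y w) = (if p = Lz then y p ^ 2 else y p)"
proof -
  show "coord p (point \<xi> l y w) = y p" by (cases p) (simp_all add: point_def)
  then show "vec2 p (point \<xi> l y w) = (if p = Lz then y p ^ 2 else y p)"
    by (auto simp: vec2_def simp del: coord.simps)
qed (simp_all add: point_def)

lemma pos_simps:
  "pos p < pos q \<Longrightarrow> p \<noteq> q" "pos p < pos q \<Longrightarrow> q \<noteq> Lz"
  by (cases q; cases p; simp)+

lemma even_submonoid:
  "(0::nat) \<in> Collect even" "\<And>i j. (i::nat) \<in> Collect even \<Longrightarrow> j \<in> Collect even \<Longrightarrow> i + j \<in> Collect even"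
  by auto

text \<open>A sum of elements of \<open>S\<close> that equals \<open>c + 2\<close> has an odd summand, at least \<open>c\<close>, so its other
  summand is \<open>2\<close> or \<open>0\<close>; but \<open>2\<close> and \<open>c + 2\<close> are missing from \<open>S\<close>. This handles the generators \<open>p q cnj z\<^sub>4\<close> with \<open>p \<noteq> q\<close>, which are the difficult ones because they satisfy
  \<open>(p q cnj z\<^sub>4) |q|\<^sup>2 = (q\<^sup>2 cnj z\<^sub>4) (p cnj q)\<close> and therefore cannot be separated from the
  other generators by their values. The weights below are such that \<open>c\<close> is the weight of the
  generator with \<open>q\<^sup>2 cnj z\<^sub>4\<close> and the one with \<open>p q cnj z\<^sub>4\<close> is heavier by \<open>2\<close>, while no generator has
  weight \<open>2\<close>.\<close>

lemma two_gap_submonoid: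
  fixes c :: nat assumes "odd c" "c > 1"
  defines "S \<equiv> {n. if even n then n \<noteq> 2 else c \<le> n \<and> n \<noteq> c + 2}"
  shows "0 \<in> S" "\<And>i j. i \<in> S \<Longrightarrow> j \<in> S \<Longrightarrow> i + j \<in> S"
proof -
  show "0 \<in> S" by (simp add: S_def)
  show "i + j \<in> S" if "i \<in> S" "j \<in> S" for i j
    using that assms(1,2) unfolding S_def mem_Collect_eq
    by (cases "even i"; cases "even j") (auto simp: odd_pos elim!: evenE)
qed

text \<open>For the generators of degree at most two in a single coordinate, the point has only that
  coordinate different from zero, where all other generators vanish.\<close>

lemma gen_Lam_irreducible: "gen (Lam i) \<notin> generated_algebra (gen ` (SO2_index - {Lam i}))"
  by (rule not_generated_by_weights[where S = "{0}" and \<kappa> = "\<lambda>_. 0" and \<nu> = 1 and e = "\<lambda>_. 0" and \<omega> = 0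
        and v = "point (\<lambda>_. 0) (\<lambda>j. if j = i then 1 else 0) (\<lambda>_. 0) 0"])
     (simp_all add: ball_SO2_index all_listed)

lemma gen_Xi_irreducible: "gen (Xi i) \<notin> generated_algebra (gen ` (SO2_index - {Xi i}))"
  by (rule not_generated_by_weights[where S = "{0}" and \<kappa> = "\<lambda>_. 1" and \<nu> = 1 and e = "\<lambda>_. 0" and \<omega> = 0
        and v = "point (\<lambda>j. if j = i then 1 else 0) (\<lambda>_. 0) (\<lambda>_. 0) 0"])
     (simp_all add: ball_SO2_index all_listed)

lemma gen_Norm_irreducible: "gen (Norm p) \<notin> generated_algebra (gen ` (SO2_index - {Norm p}))"
  by (rule not_generated_by_weights[where S = "{0}" and \<kappa> = "\<lambda>_. 0" and \<nu> = 0 and e = "\<lambda>_. 1" and \<omega> = 0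
        and v = "point (\<lambda>_. 0) (\<lambda>_. 0) (\<lambda>q. if q = p then 1 else 0) 0"])
     (auto simp: ball_SO2_index all_listed)

lemma gen_NormW_irreducible: "gen NormW \<notin> generated_algebra (gen ` (SO2_index - {NormW}))"
  by (rule not_generated_by_weights[where S = "{0}" and \<kappa> = "\<lambda>_. 0" and \<nu> = 0 and e = "\<lambda>_. 0" and \<omega> = 1
        and v = "point (\<lambda>_. 0) (\<lambda>_. 0) (\<lambda>_. 0) 1"])
     (simp_all add: ball_SO2_index all_listed)

text \<open>In the next three lemmas the phase \<open>\<phi>\<close> is the value of the monomial at the point, chosen so
  that the real or imaginary part that is not the target vanishes there. Here \<open>p\<close> gets weight \<open>2\<close>
  (for \<open>p = z\<^sup>2\<close> this means weight \<open>1\<close> for \<open>z\<close>) and \<open>q\<close> gets weight \<open>1\<close>, so that among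
  the generators that do not vanish at the point only the target has odd weight.\<close>

lemma gen_Quad_irreducible:
  assumes "pos p < pos q" and k: "k = ReM (Quad p q) \<and> \<phi> = 1 \<or> k = ImM (Quad p q) \<and> \<phi> = \<i>"
  shows "gen k \<notin> generated_algebra (gen ` (SO2_index - {k}))"
  using k pos_simps[OF assms(1)] assms(1)
  by (intro not_generated_by_weights[OF even_submonoid, where \<kappa> = "\<lambda>_. 0" and \<nu> = 0 and \<omega> = 0
        and e = "\<lambda>r. if r = p \<and> p \<noteq> Lz then 2 else 1"
        and v = "point (\<lambda>_. 0) (\<lambda>_. 0) (\<lambda>r. if r = p then 1 else if r = q then cnj \<phi> else 0) 0"])
     (auto simp: ball_SO2_index all_listed vec2_weight_def split: if_splits)

text \<open>Only \<open>p\<close> and \<open>z\<^sub>4\<close> are nonzero; the norms are even and the target is odd, because \<open>z\<^sub>4\<close> has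
  weight \<open>1\<close> and \<open>p\<close> enters squared.\<close>

lemma gen_Cubic_same_irreducible:
  assumes k: "k = ReM (Cubic p p) \<and> \<phi> = 1 \<or> k = ImM (Cubic p p) \<and> \<phi> = \<i>"
  shows "gen k \<notin> generated_algebra (gen ` (SO2_index - {k}))"
  using k
  by (intro not_generated_by_weights[OF even_submonoid, where \<kappa> = "\<lambda>_. 0" and \<nu> = 0 and \<omega> = 1
        and e = "\<lambda>_. 1"
        and v = "point (\<lambda>_. 0) (\<lambda>_. 0) (\<lambda>r. if r = p then 1 else 0) (cnj \<phi>)"])
     (auto simp: ball_SO2_index all_listed vec2_weight_def split: if_splits)

text \<open>With weights \<open>4\<close>, \<open>2\<close>, \<open>3\<close> for \<open>p\<close>, \<open>q\<close>, \<open>z\<^sub>4\<close> the norms weigh \<open>4\<close>, \<open>6\<close> or \<open>8\<close>, the product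
  \<open>p cnj q\<close> weighs \<open>6\<close>, and \<open>q\<^sup>2 cnj z\<^sub>4\<close> and \<open>p\<^sup>2 cnj z\<^sub>4\<close> weigh \<open>7\<close> and \<open>11\<close>. The target weighs \<open>9\<close>.\<close>

lemma gen_Cubic_irreducible:
  assumes "pos p < pos q" and k: "k = ReM (Cubic p q) \<and> \<phi> = 1 \<or> k = ImM (Cubic p q) \<and> \<phi> = \<i>"
  shows "gen k \<notin> generated_algebra (gen ` (SO2_index - {k}))"
  using k pos_simps[OF assms(1)] assms(1)
  by (intro not_generated_by_weights[OF two_gap_submonoid[of 7], where \<kappa> = "\<lambda>_. 0" and \<nu> = 0 and \<omega> = 3
        and e = "\<lambda>r. if r = p \<and> p \<noteq> Lz then 4 else 2"
        and v = "point (\<lambda>_. 0) (\<lambda>_. 0) (\<lambda>r. if r = p \<or> r = q then 1 else 0) (cnj \<phi>)"])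
     (auto simp: ball_SO2_index all_listed vec2_weight_def split: if_splits)

lemma gen_XiXi_irreducible:
  assumes "(i, j) \<in> xi_pairs"
  shows "gen (XiXi i j) \<notin> generated_algebra (gen ` (O2_index - {XiXi i j}))"
proof (cases "i = j")
  case True
  then show ?thesis
    by (intro not_generated_by_weights[where S = "{0}" and \<kappa> = "\<lambda>_. 1" and \<nu> = 0 and e = "\<lambda>_. 0" and \<omega> = 0
          and v = "point (\<lambda>k. if k = i then 1 else 0) (\<lambda>_. 0) (\<lambda>_. 0) 0"])
       (auto simp: ball_O2_index all_listed xi_pairs_def)
next
  case False
  with assms show ?thesis
    by (intro not_generated_by_weights[OF even_submonoid, where \<kappa> = "\<lambda>k. if k = i then 1 else 2"
          and \<nu> = 0 and e = "\<lambda>_. 0" and \<omega> = 0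
          and v = "point (\<lambda>k. if k = i \<or> k = j then 1 else 0) (\<lambda>_. 0) (\<lambda>_. 0) 0"])
       (auto simp: ball_O2_index all_listed xi_pairs_def)
qed

text \<open>For the products \<open>\<xi>\<^sub>i Im m\<close> the same weights work with an additional weight \<open>2\<close> for \<open>\<xi>\<^sub>i\<close>. The
  point makes \<open>m\<close> imaginary, which removes \<open>Re m\<close>.\<close>

lemma gen_XiIm_Quad_irreducible:
  assumes "pos p < pos q"
  shows "gen (XiIm i (Quad p q)) \<notin> generated_algebra (gen ` (O2_index - {XiIm i (Quad p q)}))"
  using pos_simps[OF assms] assms
  by (intro not_generated_by_weights[OF even_submonoid, where \<kappa> = "\<lambda>_. 2" and \<nu> = 0 and \<omega> = 0
        and e = "\<lambda>r. if r = p \<and> p \<noteq> Lz then 2 else 1"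
        and v = "point (\<lambda>j. if j = i then 1 else 0) (\<lambda>_. 0)
          (\<lambda>r. if r = p then 1 else if r = q then - \<i> else 0) 0"])
     (auto simp: ball_O2_index all_listed vec2_weight_def split: if_splits)

lemma gen_XiIm_Cubic_same_irreducible:
  "gen (XiIm i (Cubic p p)) \<notin> generated_algebra (gen ` (O2_index - {XiIm i (Cubic p p)}))"
  by (intro not_generated_by_weights[OF even_submonoid, where \<kappa> = "\<lambda>_. 2" and \<nu> = 0 and \<omega> = 1
        and e = "\<lambda>_. 1"
        and v = "point (\<lambda>j. if j = i then 1 else 0) (\<lambda>_. 0) (\<lambda>r. if r = p then 1 else 0) (- \<i>)"])
     (auto simp: ball_O2_index all_listed vec2_weight_def split: if_splits)

text \<open>Now \<open>\<xi>\<^sub>i Im (q\<^sup>2 cnj z\<^sub>4)\<close> and \<open>\<xi>\<^sub>i Im (p\<^sup>2 cnj z\<^sub>4)\<close> weigh \<open>9\<close> and \<open>13\<close>, and the target weighs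
  \<open>11\<close>. The products \<open>\<xi>\<^sub>i Im (p cnj q)\<close> vanish at the point.\<close>

lemma gen_XiIm_Cubic_irreducible:
  assumes "pos p < pos q"
  shows "gen (XiIm i (Cubic p q)) \<notin> generated_algebra (gen ` (O2_index - {XiIm i (Cubic p q)}))"
  using pos_simps[OF assms] assms
  by (intro not_generated_by_weights[OF two_gap_submonoid[of 9], where \<kappa> = "\<lambda>_. 2" and \<nu> = 0 and \<omega> = 3
        and e = "\<lambda>r. if r = p \<and> p \<noteq> Lz then 4 else 2"
        and v = "point (\<lambda>j. if j = i then 1 else 0) (\<lambda>_. 0)
          (\<lambda>r. if r = p \<or> r = q then 1 else 0) (- \<i>)"])
     (auto simp: ball_O2_index all_listed vec2_weight_def split: if_splits)

lemma SO2_irreducible: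
  assumes "k \<in> SO2_index"
  shows "gen k \<notin> generated_algebra (gen ` (SO2_index - {k}))"
proof -
  have "\<forall>k\<in>SO2_index. gen k \<notin> generated_algebra (gen ` (SO2_index - {k}))"
    unfolding ball_SO2_index all_listed
    using gen_Quad_irreducible gen_Cubic_same_irreducible gen_Cubic_irreducible
    by (auto simp: gen_Lam_irreducible gen_Xi_irreducible gen_Norm_irreducible gen_NormW_irreducible
        le_less pos_eq_iff)
  with assms show ?thesis by blast
qed

text \<open>A generator common to both groups inherits irreducibility from \<open>SO(2)\<close>: the remaining \<open>O(2)\<close>
  generators are polynomials in the remaining \<open>SO(2)\<close> generators.\<close>

lemma O2_irreducible:
  assumes "k \<in> O2_index"
  shows "gen k \<notin> generated_algebra (gen ` (O2_index - {k}))"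
proof -
  have common: "gen k \<notin> generated_algebra (gen ` (O2_index - {k}))" if "k \<in> common_index" for k
  proof
    let ?A = "generated_algebra (gen ` (SO2_index - {k}))"
    assume "gen k \<in> generated_algebra (gen ` (O2_index - {k}))"
    moreover have "gen ` (O2_index - {k}) \<subseteq> ?A"
    proof -
      have Xi: "gen (Xi i) \<in> ?A" and Im: "listed m \<Longrightarrow> gen (ImM m) \<in> ?A" for i m
        using that by (auto intro!: generated_algebra.gen imageI simp: SO2_index_def common_index_def)
      have XiXi: "gen (XiXi i j) \<in> ?A" for i j
        using generated_algebra.mult[OF Xi[of i] Xi[of j]] by (simp add: gen_fun)
      have XiIm: "gen (XiIm i m) \<in> ?A" if "listed m" for i m
        using generated_algebra.mult[OF Xi[of i] Im[OF that]] by (simp add: gen_fun)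
      have common: "gen j \<in> ?A" if "j \<in> common_index" "j \<noteq> k" for j
        using that by (auto intro!: generated_algebra.gen imageI simp: SO2_index_def)
      show ?thesis
      proof (rule image_subsetI)
        fix j assume j: "j \<in> O2_index - {k}"
        then show "gen j \<in> ?A"
          using common[of j] by (cases "j \<in> common_index") (auto simp: O2_index_def XiXi XiIm)
      qed
    qed
    ultimately have "gen k \<in> ?A" by (rule generated_algebra_mono[rotated])
    then show False using SO2_irreducible[of k] that by (auto simp: SO2_index_def)
  qed
  have [simp]: "Lam i \<in> common_index" "Norm p \<in> common_index" "NormW \<in> common_index"
    "ReM m \<in> common_index \<longleftrightarrow> listed m" for i p m
    by (auto simp: common_index_def)
  have "\<forall>k\<in>O2_index. gen k \<notin> generated_algebra (gen ` (O2_index - {k}))"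
    unfolding ball_O2_index all_listed
    by (auto simp: gen_XiXi_irreducible gen_XiIm_Quad_irreducible gen_XiIm_Cubic_same_irreducible
        gen_XiIm_Cubic_irreducible le_less pos_eq_iff common)
  with assms show ?thesis by blast
qed

lemma inj_on_if_irreducible:
  assumes "\<And>k. k \<in> J \<Longrightarrow> g k \<notin> generated_algebra (g ` (J - {k}))"
  shows "inj_on g J"
proof (rule inj_onI, rule ccontr)
  fix j k assume jk: "j \<in> J" "k \<in> J" "g j = g k" "j \<noteq> k"
  then have "g k \<in> generated_algebra (g ` (J - {k}))"
    by (intro generated_algebra.gen image_eqI[of _ _ j]) auto
  with assms[OF jk(2)] show False by blast
qed

lemma generated_algebra_psubset_if_irreducible:
  assumes "\<And>k. k \<in> J \<Longrightarrow> g k \<notin> generated_algebra (g ` (J - {k}))" and "C \<subset> g ` J"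
  shows "generated_algebra C \<noteq> generated_algebra (g ` J)"
proof -
  from assms(2) obtain k where k: "k \<in> J" "g k \<notin> C" by blast
  with assms(2) have "C \<subseteq> generated_algebra (g ` (J - {k}))"
    by (blast intro: generated_algebra.gen)
  with assms(1)[OF k(1)] have "g k \<notin> generated_algebra C"
    using generated_algebra_mono by blast
  moreover have "g k \<in> generated_algebra (g ` J)"
    using k by (intro generated_algebra.gen) auto
  ultimately show ?thesis by blast
qed


section \<open>Counting\<close>

abbreviation order_of :: "index \<Rightarrow> nat" where
  "order_of \<equiv> weight (\<lambda>_. 0) 0 (\<lambda>p. if p = Lz then 1 else 0) 0"

lemma inj_index [simp]:
  "inj_on Lam A" "inj_on Xi A" "inj_on Norm B" "inj_on ReM C" "inj_on ImM C"
  "inj_on (case_prod XiXi) D" "inj_on (case_prod XiIm) E"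
  by (auto intro!: inj_onI)

text \<open>The weights in the third count are those of \<open>order_of\<close>.\<close>

lemma card_listed: "finite (Collect listed)" "card (Collect listed) = 25"
  "card {m \<in> Collect listed. mon_weight (\<lambda>p. if p = Lz then 1 else 0) 0 m = 0} = 16"
proof -
  show fin: "finite (Collect listed)" and "card (Collect listed) = 25"
    by (simp_all add: Collect_listed)
  show "card {m \<in> Collect listed. mon_weight (\<lambda>p. if p = Lz then 1 else 0) 0 m = 0} = 16"
    unfolding card_eq_sum sum.inter_filter[OF fin] unfolding Collect_listed
    by (simp add: vec2_weight_def)
qed

lemma finite_letter [simp]: "finite (A :: letter set)"
  by (rule finite_subset[OF subset_UNIV]) (simp add: UNIV_letter)

lemma card_letter: "CARD(letter) = 5" "card (- {Lz}) = 4"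
  by (simp_all add: Compl_eq_Diff_UNIV UNIV_letter)

lemma card_common_index:
  "finite common_index" "card common_index = 34" "card {j \<in> common_index. order_of j = 0} = 24"
proof -
  note [simp] = card_listed card_listed(3)[simplified] card_image card_letter
  show "finite common_index" by (simp add: common_index_def)
  show "card common_index = 34"
    unfolding common_index_def by (subst card_Un_disjoint; (auto; fail)?)+
  have "{j \<in> common_index. order_of j = 0} = range Lam \<union> Norm ` (- {Lz}) \<union> {NormW} \<union>
      ReM ` {m \<in> Collect listed. mon_weight (\<lambda>p. if p = Lz then 1 else 0) 0 m = 0}"
    by (auto simp: common_index_def split: if_splits)
  also have "card \<dots> = 24"
    by (subst card_Un_disjoint; (auto; fail)?)+
  finally show "card {j \<in> common_index. order_of j = 0} = 24" .
qed

lemma card_SO2_index: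
  "finite SO2_index" "card SO2_index = 62" "card {j \<in> SO2_index. order_of j = 0} = 43"
proof -
  note [simp] = card_listed card_listed(3)[simplified] card_image card_common_index
  show "finite SO2_index" by (simp add: SO2_index_def)
  show "card SO2_index = 62"
    unfolding SO2_index_def
    by (subst card_Un_disjoint; (auto simp: common_index_def; fail)?)+ simp
  have "{j \<in> SO2_index. order_of j = 0} = {j \<in> common_index. order_of j = 0} \<union> range Xi \<union>
      ImM ` {m \<in> Collect listed. mon_weight (\<lambda>p. if p = Lz then 1 else 0) 0 m = 0}"
    by (auto simp: SO2_index_def)
  also have "card \<dots> = 43"
    by (subst card_Un_disjoint; (auto simp: common_index_def; fail)?)+ simp
  finally show "card {j \<in> SO2_index. order_of j = 0} = 43" .
qed

lemma card_O2_index: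
  "finite O2_index" "card O2_index = 115" "card {j \<in> O2_index. order_of j = 0} = 78"
proof -
  have xi_pairs: "finite xi_pairs" "card xi_pairs = 6"
    by (simp_all add: xi_pairs_def)
  note [simp] = card_listed card_listed(3)[simplified] card_image card_common_index xi_pairs
  show "finite O2_index" by (simp add: O2_index_def)
  show "card O2_index = 115"
    unfolding O2_index_def
    by (subst card_Un_disjoint; (auto simp: common_index_def; fail)?)+ (simp add: card_cartesian_product)
  have "{j \<in> O2_index. order_of j = 0} = {j \<in> common_index. order_of j = 0} \<union>
      case_prod XiXi ` xi_pairs \<union> case_prod XiIm ` (UNIV \<times>
        {m \<in> Collect listed. mon_weight (\<lambda>p. if p = Lz then 1 else 0) 0 m = 0})"
    by (auto simp: O2_index_def)
  also have "card \<dots> = 78"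
    by (subst card_Un_disjoint; (auto simp: common_index_def; fail)?)+ (simp add: card_cartesian_product)
  finally show "card {j \<in> O2_index. order_of j = 0} = 78" .
qed

text \<open>The requirement that \<open>f\<close> does not vanish identically excludes the zero function, which has
  order \<open>0\<close> although it is homogeneous of every degree.\<close>

lemma cov_order_eq:
  assumes "\<And>t v x. f (v, t *\<^sub>R x) = t ^ n * f (v, x)" and "f \<noteq> (\<lambda>_. 0)"
  shows "cov_order f = n"
  unfolding cov_order_def
proof (rule Least_equality)
  show "\<forall>v x. \<exists>p :: real poly. degree p \<le> n \<and> (\<forall>t. f (v, t *\<^sub>R x) = poly p t)"
  proof (intro allI)
    fix v x
    show "\<exists>p :: real poly. degree p \<le> n \<and> (\<forall>t. f (v, t *\<^sub>R x) = poly p t)"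
      by (intro exI[of _ "monom (f (v, x)) n"]) (simp add: assms(1) poly_monom degree_monom_le)
  qed
next
  fix k assume k: "\<forall>v x. \<exists>p :: real poly. degree p \<le> k \<and> (\<forall>t. f (v, t *\<^sub>R x) = poly p t)"
  from assms(2) obtain v x where nz: "f (v, x) \<noteq> 0" by (auto simp: fun_eq_iff)
  from k obtain p :: "real poly" where p: "degree p \<le> k" "\<And>t. f (v, t *\<^sub>R x) = poly p t" by blast
  then have "poly p = poly (monom (f (v, x)) n)" by (auto simp: fun_eq_iff assms(1) poly_monom mult.commute)
  then have "p = monom (f (v, x)) n" by (simp add: poly_eq_poly_eq_iff)
  with p(1) nz show "n \<le> k" by (simp add: degree_monom_eq)
qed


section \<open>Invariance of the generators\<close>

definition pt_act :: "real^2^2 \<Rightarrow> pt \<Rightarrow> pt" where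
  "pt_act g = (\<lambda>(h, x). (harm4_act g h, g *v x))"

text \<open>An element of \<open>O(2)\<close> acts on each complex coordinate by \<open>twist\<close> and a power of the unit complex
  number \<open>unit_of\<close>, its first column.\<close>

definition unit_of :: "real^2^2 \<Rightarrow> complex" where
  "unit_of g = Complex (g$1$1) (g$2$1)"

definition twist :: "real^2^2 \<Rightarrow> complex \<Rightarrow> complex" where
  "twist g w = (if det g = 1 then w else cnj w)"

lemma SO2_eq: "SO2 = {g \<in> O2. det g = 1}"
  by (auto simp: SO2_def O2_def rotation_matrix_def)

lemma unit_of_cnj: "g \<in> O2 \<Longrightarrow> unit_of g * cnj (unit_of g) = 1"
  using O2_entries(3)[of g] by (simp add: unit_of_def complex_eq_iff)

lemma twist_simps [simp]:
  "twist g (v * w) = twist g v * twist g w" "twist g (cnj w) = cnj (twist g w)"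
  "twist g (w ^ n) = twist g w ^ n" "Re (twist g w) = Re w"
  by (simp_all add: twist_def)

lemma pt_act_coords:
  assumes "g \<in> O2"
  shows "xi i (pt_act g v) = det g * xi i v" "lam i (pt_act g v) = lam i v"
    "coord p (pt_act g v) = unit_of g ^ (if p = Lz then 1 else 2) * twist g (coord p v)"
    "z4 (pt_act g v) = unit_of g ^ 4 * twist g (z4 v)"
proof -
  obtain \<xi> l a b c d w x where v: "v = ((\<xi>, l, a, b, c, d, w), x)" by (metis prod.exhaust)
  show "xi i (pt_act g v) = det g * xi i v" "lam i (pt_act g v) = lam i v"
    "z4 (pt_act g v) = unit_of g ^ 4 * twist g (z4 v)"
    by (simp_all add: v pt_act_def harm_act_def unit_of_def twist_def)
  show "coord p (pt_act g v) = unit_of g ^ (if p = Lz then 1 else 2) * twist g (coord p v)"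
    using O2_entries[OF assms]
    by (cases p) (auto simp: v pt_act_def harm_act_def unit_of_def twist_def complex_eq_iff
        matrix_vector_mult_def sum_2)
qed

lemma vec2_pt_act: "g \<in> O2 \<Longrightarrow> vec2 p (pt_act g v) = unit_of g ^ 2 * twist g (vec2 p v)"
  by (auto simp: vec2_def pt_act_coords power_mult_distrib simp del: coord.simps)

text \<open>The powers of the unit \<open>u\<close> cancel against those of \<open>cnj u\<close>: this is what charge \<open>0\<close> means.\<close>

lemma mon_pt_act:
  assumes "g \<in> O2" shows "mon m (pt_act g v) = twist g (mon m v)"
proof -
  define u where "u = unit_of g"
  have u: "u * cnj u = 1" using unit_of_cnj[OF assms] by (simp add: u_def)
  have "u ^ 2 * a * cnj (u ^ 2 * b) = a * cnj b"
    "u ^ 2 * a * (u ^ 2 * b) * cnj (u ^ 4 * c) = a * b * cnj c" for a b c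
    using u unfolding complex_cnj_mult complex_cnj_power by algebra+
  then show ?thesis
    by (cases m) (simp_all add: assms vec2_pt_act pt_act_coords u_def[symmetric])
qed

lemma norm_pt_act:
  assumes "g \<in> O2"
  shows "gen (Norm p) (pt_act g v) = gen (Norm p) v" "gen NormW (pt_act g v) = gen NormW v"
proof -
  have "Re (unit_of g ^ n * twist g w * cnj (unit_of g ^ n * twist g w)) = Re (w * cnj w)" for n w
  proof -
    have "unit_of g ^ n * twist g w * cnj (unit_of g ^ n * twist g w) =
        (unit_of g * cnj (unit_of g)) ^ n * twist g (w * cnj w)"
      by (simp add: power_mult_distrib)
    then show ?thesis by (simp only: unit_of_cnj[OF assms] twist_simps(4) power_one mult_1)
  qed
  then show "gen (Norm p) (pt_act g v) = gen (Norm p) v" "gen NormW (pt_act g v) = gen NormW v"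
    by (simp_all only: gen.simps pt_act_coords[OF assms])
qed

lemma gen_invariant:
  "g \<in> SO2 \<Longrightarrow> j \<in> SO2_index \<Longrightarrow> gen j (pt_act g v) = gen j v"
  "g \<in> O2 \<Longrightarrow> j \<in> O2_index \<Longrightarrow> gen j (pt_act g v) = gen j v"
proof -
  have "\<forall>j\<in>SO2_index. gen j (pt_act g v) = gen j v" if "g \<in> SO2"
    using that norm_pt_act
    by (auto simp: ball_SO2_index SO2_eq pt_act_coords mon_pt_act twist_def simp del: gen.simps(3,4))
  then show "g \<in> SO2 \<Longrightarrow> j \<in> SO2_index \<Longrightarrow> gen j (pt_act g v) = gen j v" by blast
  have "\<forall>j\<in>O2_index. gen j (pt_act g v) = gen j v" if "g \<in> O2"
    using that norm_pt_act[OF that] O2_entries(4)[OF that]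
    by (auto simp: ball_O2_index pt_act_coords mon_pt_act twist_def simp del: gen.simps(3,4))
  then show "g \<in> O2 \<Longrightarrow> j \<in> O2_index \<Longrightarrow> gen j (pt_act g v) = gen j v" by blast
qed

text \<open>The algebra generated by \<open>B\<close> with complex coefficients. It allows one to work with monomials
  instead of their real and imaginary parts.\<close>

definition complexified :: "('v \<Rightarrow> real) set \<Rightarrow> ('v \<Rightarrow> complex) set" where
  "complexified B = {F. (\<lambda>v. Re (F v)) \<in> generated_algebra B \<and> (\<lambda>v. Im (F v)) \<in> generated_algebra B}"

lemma complexified_const: "(\<lambda>_. c) \<in> complexified B"
  by (simp add: complexified_def generated_algebra.const)

lemma complexified_of_real:
  "f \<in> generated_algebra B \<Longrightarrow> (\<lambda>v. complex_of_real (f v)) \<in> complexified B"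
  by (simp add: complexified_def generated_algebra.const)

lemma complexified_add: "F \<in> complexified B \<Longrightarrow> G \<in> complexified B \<Longrightarrow> (\<lambda>v. F v + G v) \<in> complexified B"
  by (simp add: complexified_def generated_algebra.add)

lemma complexified_mult: "F \<in> complexified B \<Longrightarrow> G \<in> complexified B \<Longrightarrow> (\<lambda>v. F v * G v) \<in> complexified B"
  by (simp add: complexified_def generated_algebra_closed)

lemma complexified_cnj: "F \<in> complexified B \<Longrightarrow> (\<lambda>v. cnj (F v)) \<in> complexified B"
  by (simp add: complexified_def generated_algebra_minus)

lemmas complexified_closed = complexified_const complexified_add complexified_mult complexified_cnj

lemma generated_algebra_linear_forms:
  "generated_algebra (Collect bounded_linear) = Collect real_polynomial_function"
proof (intro equalityI subsetI CollectI)
  fix f :: "'a \<Rightarrow> real"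
  assume "f \<in> generated_algebra (Collect bounded_linear)"
  then show "real_polynomial_function f"
    by induction (auto intro: real_polynomial_function.intros)
next
  fix f :: "'a \<Rightarrow> real"
  assume "f \<in> Collect real_polynomial_function"
  then have "real_polynomial_function f" by simp
  then show "f \<in> generated_algebra (Collect bounded_linear)"
    by induction (auto intro: generated_algebra.intros)
qed

lemma linear_coords:
  "linear (xi i)" "linear (lam i)" "linear (\<lambda>v. Re (coord p v))" "linear (\<lambda>v. Im (coord p v))"
  "linear (\<lambda>v. Re (z4 v))" "linear (\<lambda>v. Im (z4 v))"
proof -
  show "linear (\<lambda>v. Re (coord p v))" "linear (\<lambda>v. Im (coord p v))"
    by (cases p; simp add: linear_iff)+
qed (simp_all add: linear_iff)

text \<open>Polynomial functions form the algebra generated by the linear forms, so the closure properties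
  of \<open>complexified\<close> apply to them.\<close>

lemma gen_polynomial: "real_polynomial_function (gen j)"
proof -
  let ?L = "Collect bounded_linear :: (pt \<Rightarrow> real) set"
  have real: "xi i \<in> generated_algebra ?L" "lam i \<in> generated_algebra ?L" for i
    using linear_coords by (auto simp: linear_conv_bounded_linear intro!: generated_algebra.gen)
  have coord: "coord p \<in> complexified ?L" "z4 \<in> complexified ?L" for p
    using linear_coords
    by (auto simp: complexified_def linear_conv_bounded_linear intro!: generated_algebra.gen)
  have vec2: "vec2 p \<in> complexified ?L" for p
  proof -
    have "vec2 p = (\<lambda>v. if p = Lz then coord p v * coord p v else coord p v)"
      by (simp add: vec2_def fun_eq_iff power2_eq_square del: coord.simps)
    then show ?thesis using complexified_mult[OF coord(1) coord(1)] coord(1) by (cases "p = Lz") (simp_all del: coord.simps)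
  qed
  have mon: "mon m \<in> complexified ?L" for m
    by (cases m) (auto simp: mon_fun intro!: complexified_closed vec2 coord)
  have parts: "(\<lambda>v. Re (F v)) \<in> generated_algebra ?L" "(\<lambda>v. Im (F v)) \<in> generated_algebra ?L"
    if "F \<in> complexified ?L" for F
    using that by (auto simp: complexified_def)
  have "gen j \<in> generated_algebra ?L"
    by (cases j) (auto simp only: gen_fun intro!: real parts generated_algebra.mult mon
        complexified_mult complexified_cnj coord)
  then show ?thesis by (simp add: generated_algebra_linear_forms)
qed

lemma generated_algebra_subset_Inv:
  assumes "\<And>g j v. g \<in> G \<Longrightarrow> j \<in> J \<Longrightarrow> gen j (pt_act g v) = gen j v"
  shows "generated_algebra (gen ` J) \<subseteq> Inv G pt_act"
proof
  fix f assume "f \<in> generated_algebra (gen ` J)"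
  then show "f \<in> Inv G pt_act"
    by induction
       (use assms gen_polynomial in \<open>auto simp: Inv_def intro: real_polynomial_function.intros\<close>)
qed


section \<open>Rotation invariants\<close>

text \<open>The list contains each product once, up to order and conjugation, and leaves out the squared
  moduli. For \<open>p = q = z\<^sup>2\<close> the product is the square of the generator \<open>z cnj z\<close>.\<close>

lemma quadratic_mem:
  assumes mon: "\<And>m. listed m \<Longrightarrow> mon m \<in> M" and cnj: "\<And>F. F \<in> M \<Longrightarrow> (\<lambda>v. cnj (F v)) \<in> M"
    and common: "\<And>f. f \<in> generated_algebra (gen ` common_index) \<Longrightarrow> (\<lambda>v. complex_of_real (f v)) \<in> M"
  shows "(\<lambda>v. vec2 p v * cnj (vec2 q v)) \<in> M"
proof -
  consider "p = q" | "pos p < pos q" | "pos q < pos p"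
    using pos_eq_iff[of p q] by linarith
  then show ?thesis
  proof cases
    case 1
    have N: "gen (Norm p) \<in> generated_algebra (gen ` common_index)"
      by (intro generated_algebra.gen imageI) (simp add: common_index_def)
    have norm: "coord p v * cnj (coord p v) = complex_of_real (gen (Norm p) v)" for v
      by (simp add: complex_eq_iff)
    have "\<exists>f\<in>generated_algebra (gen ` common_index). \<forall>v. vec2 p v * cnj (vec2 p v) = complex_of_real (f v)"
    proof (cases "p = Lz")
      case True
      have "vec2 p v * cnj (vec2 p v) = (coord p v * cnj (coord p v)) * (coord p v * cnj (coord p v))" for v
        using True by (simp add: vec2_def power2_eq_square)
      then show ?thesis
        unfolding norm by (intro bexI[OF _ generated_algebra.mult[OF N N]]) simp
    next
      case False
      then show ?thesis using norm by (intro bexI[OF _ N]) (simp add: vec2_def)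
    qed
    then obtain f where "f \<in> generated_algebra (gen ` common_index)"
      "\<And>v. vec2 p v * cnj (vec2 p v) = complex_of_real (f v)"
      by blast
    with \<open>p = q\<close> show ?thesis using common[of f] by simp
  next
    case 2
    then show ?thesis using mon[of "Quad p q"] by (simp add: mon_fun)
  next
    case 3
    then show ?thesis using cnj[OF mon[of "Quad q p"]] by (simp add: mon_fun mult.commute)
  qed
qed

lemma cubic_mem:
  assumes mon: "\<And>m. listed m \<Longrightarrow> mon m \<in> M"
  shows "(\<lambda>v. vec2 p v * vec2 q v * cnj (z4 v)) \<in> M"
proof (cases "pos p \<le> pos q")
  case True
  then show ?thesis using mon[of "Cubic p q"] by (simp add: mon_fun)
next
  case False
  then show ?thesis using mon[of "Cubic q p"] by (simp add: mon_fun mult_ac)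
qed

abbreviation SO2_complex :: "(pt \<Rightarrow> complex) set" where
  "SO2_complex \<equiv> complexified (gen ` SO2_index)"

lemma SO2_complex_gen:
  "j \<in> SO2_index \<Longrightarrow> (\<lambda>v. complex_of_real (gen j v)) \<in> SO2_complex"
  by (intro complexified_of_real generated_algebra.gen) auto

lemma SO2_complex_mon: "listed m \<Longrightarrow> mon m \<in> SO2_complex"
proof -
  assume "listed m"
  then have "gen (ReM m) \<in> gen ` SO2_index" "gen (ImM m) \<in> gen ` SO2_index"
    by (auto simp: SO2_index_def common_index_def)
  then show ?thesis by (simp add: complexified_def gen_fun generated_algebra.gen)
qed

lemma SO2_complex_norms:
  "(\<lambda>v. coord p v * cnj (coord p v)) \<in> SO2_complex" "(\<lambda>v. z4 v * cnj (z4 v)) \<in> SO2_complex"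
proof -
  have "w * cnj w = complex_of_real (Re (w * cnj w))" for w
    by (simp add: complex_eq_iff)
  moreover have "Norm p \<in> SO2_index" "NormW \<in> SO2_index"
    by (auto simp: SO2_index_def common_index_def)
  ultimately show "(\<lambda>v. coord p v * cnj (coord p v)) \<in> SO2_complex" "(\<lambda>v. z4 v * cnj (z4 v)) \<in> SO2_complex"
    using SO2_complex_gen[of "Norm p"] SO2_complex_gen[of NormW] by simp_all
qed

lemma SO2_complex_products:
  "(\<lambda>v. vec2 p v * cnj (vec2 q v)) \<in> SO2_complex"
  "(\<lambda>v. vec2 p v * vec2 q v * cnj (z4 v)) \<in> SO2_complex"
proof -
  have common: "(\<lambda>v. complex_of_real (f v)) \<in> SO2_complex"
    if "f \<in> generated_algebra (gen ` common_index)" for f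
    by (intro complexified_of_real generated_algebra_mono[OF _ that])
       (auto simp: SO2_index_def intro: generated_algebra.gen)
  show "(\<lambda>v. vec2 p v * cnj (vec2 q v)) \<in> SO2_complex"
    "(\<lambda>v. vec2 p v * vec2 q v * cnj (z4 v)) \<in> SO2_complex"
    by (intro quadratic_mem cubic_mem SO2_complex_mon complexified_cnj common; assumption)+
qed

definition power_product ::
    "letter list \<Rightarrow> letter list \<Rightarrow> nat \<Rightarrow> nat \<Rightarrow> nat \<Rightarrow> nat \<Rightarrow> pt \<Rightarrow> complex" where
  "power_product P Q j k m n v = (\<Prod>p\<leftarrow>P. vec2 p v) * cnj (\<Prod>q\<leftarrow>Q. vec2 q v) *
     z4 v ^ j * cnj (z4 v) ^ k * zx v ^ m * cnj (zx v) ^ n"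

text \<open>The hypothesis says that the charge is \<open>0\<close>. A pair of factors \<open>z\<close> is traded for one factor \<open>z\<^sup>2\<close>
  of \<open>P\<close>, and then \<open>m = n\<close> by parity. Afterwards one of the neutral factors \<open>|z|\<^sup>2\<close>, \<open>p cnj q\<close>, \<open>|z\<^sub>4|\<^sup>2\<close>,
  \<open>p p' cnj z\<^sub>4\<close> or the conjugate of the last one can be split off: if neither \<open>P\<close> and \<open>Q\<close> nor \<open>j\<close> and
  \<open>k\<close> are both nontrivial, a factor \<open>cnj z\<^sub>4\<close> is balanced by at least two factors of \<open>P\<close>, and a
  factor \<open>z\<^sub>4\<close> by two factors of \<open>Q\<close>.\<close>

lemma power_product_balanced:
  "2 * length P + 4 * j + m = 2 * length Q + 4 * k + n \<Longrightarrow> power_product P Q j k m n \<in> SO2_complex"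
proof (induction "length P + length Q + j + k + m + n" arbitrary: P Q j k m n rule: less_induct)
  case less
  note balanced = less.prems
  have factor: "power_product P Q j k m n \<in> SO2_complex"
    if "F \<in> SO2_complex" "\<And>v. power_product P Q j k m n v = F v * power_product P' Q' j' k' m' n' v"
      "2 * length P' + 4 * j' + m' = 2 * length Q' + 4 * k' + n'"
      "length P' + length Q' + j' + k' + m' + n' < length P + length Q + j + k + m + n"
    for F P' Q' j' k' m' n'
    using complexified_mult[OF that(1) less.hyps[OF that(4,3)]] by (simp flip: that(2))
  consider "m \<ge> 2" | "n \<ge> 2" | "m = 1" "n = 1" | p P' q Q' where "m = 0" "n = 0" "P = p # P'" "Q = q # Q'"
    | "m = 0" "n = 0" "j > 0" "k > 0" | p p' P' where "m = 0" "n = 0" "k > 0" "P = p # p' # P'"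
    | q q' Q' where "m = 0" "n = 0" "j > 0" "Q = q # q' # Q'"
    | "P = []" "Q = []" "j = 0" "k = 0" "m = 0" "n = 0"
  proof -
    have "m \<ge> 2 \<or> n \<ge> 2 \<or> m = n"
      using balanced by presburger
    then consider "m \<ge> 2" | "n \<ge> 2" | "m = 1" "n = 1" | "m = 0" "n = 0" by linarith
    then show thesis
    proof cases
      case 4
      with balanced show thesis
        by (cases P; cases Q; cases "tl P"; cases "tl Q"; cases j; cases k)
           (auto intro: that)
    qed (use that in blast)+
  qed
  then show ?case
  proof cases
    case 1
    then obtain m' where "m = Suc (Suc m')" by (metis add_2_eq_Suc le_Suc_ex)
    then show ?thesis using balanced
      by (intro factor[OF complexified_const[of 1], of "Lz # P" Q j k m' n])
         (simp_all add: power_product_def vec2_def power2_eq_square mult_ac)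
  next
    case 2
    then obtain n' where "n = Suc (Suc n')" by (metis add_2_eq_Suc le_Suc_ex)
    then show ?thesis using balanced
      by (intro factor[OF complexified_const[of 1], of P "Lz # Q" j k m n'])
         (simp_all add: power_product_def vec2_def power2_eq_square mult_ac)
  next
    case 3
    then show ?thesis using balanced
      by (intro factor[OF SO2_complex_norms(1)[of Lz], of P Q j k 0 0])
         (simp_all add: power_product_def mult_ac)
  next
    case 4
    then show ?thesis using balanced
      by (intro factor[OF SO2_complex_products(1)[of p q], of P' Q' j k m n])
         (simp_all add: power_product_def mult_ac)
  next
    case 5
    then obtain j' k' where "j = Suc j'" "k = Suc k'" by (metis gr0_implies_Suc)
    then show ?thesis using balanced
      by (intro factor[OF SO2_complex_norms(2), of P Q j' k' m n])
         (simp_all add: power_product_def mult_ac)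
  next
    case 6
    then obtain k' where "k = Suc k'" by (metis gr0_implies_Suc)
    then show ?thesis using balanced 6
      by (intro factor[OF SO2_complex_products(2)[of p p'], of P' Q j k' m n])
         (simp_all add: power_product_def mult_ac)
  next
    case 7
    then obtain j' where "j = Suc j'" by (metis gr0_implies_Suc)
    then show ?thesis using balanced 7
      by (intro factor[OF complexified_cnj[OF SO2_complex_products(2)[of q q']], of P Q' j' k m n])
         (simp_all add: power_product_def mult_ac)
  next
    case 8
    then have "power_product P Q j k m n = (\<lambda>_. 1)" by (simp add: power_product_def fun_eq_iff)
    then show ?thesis by (simp add: complexified_const)
  qed
qed

lemma rot2_SO2: "rot2 \<theta> \<in> SO2"
  by (simp add: SO2_def rotation_matrix_def orthogonal_matrix det_2 rot2_def vec_eq_iff forall_2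
      matrix_matrix_mult_def transpose_def mat_def sum_2 flip: power2_eq_square)

definition charge :: "letter list \<Rightarrow> letter list \<Rightarrow> nat \<Rightarrow> nat \<Rightarrow> nat \<Rightarrow> nat \<Rightarrow> int" where
  "charge P Q j k m n = int (2 * length P + 4 * j + m) - int (2 * length Q + 4 * k + n)"

lemma power_product_rot2:
  "power_product P Q j k m n (pt_act (rot2 \<theta>) v) =
     cis (of_int (charge P Q j k m n) * \<theta>) * power_product P Q j k m n v"
proof -
  have rot: "rot2 \<theta> \<in> O2" "twist (rot2 \<theta>) w = w" "unit_of (rot2 \<theta>) = cis \<theta>" for w
    using rot2_SO2[of \<theta>] by (auto simp: SO2_eq twist_def unit_of_def rot2_def complex_eq_iff)
  have vec2: "vec2 p (pt_act (rot2 \<theta>) v) = cis \<theta> ^ 2 * vec2 p v" for p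
    by (simp add: vec2_pt_act rot)
  have prod: "(\<Prod>p\<leftarrow>P. vec2 p (pt_act (rot2 \<theta>) v)) = cis \<theta> ^ (2 * length P) * (\<Prod>p\<leftarrow>P. vec2 p v)" for P
    unfolding vec2 by (induction P) (simp_all add: power_add mult_ac power2_eq_square)
  have z4: "z4 (pt_act (rot2 \<theta>) v) = cis \<theta> ^ 4 * z4 v"
    by (simp add: pt_act_coords rot)
  have zx: "zx (pt_act (rot2 \<theta>) v) = cis \<theta> * zx v"
    using pt_act_coords(3)[OF rot(1), of Lz] by (simp add: rot)
  have "power_product P Q j k m n (pt_act (rot2 \<theta>) v) =
      cis \<theta> ^ (2 * length P + 4 * j + m) * cnj (cis \<theta>) ^ (2 * length Q + 4 * k + n) * power_product P Q j k m n v"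
    unfolding power_product_def prod z4 zx
    by (simp add: power_mult_distrib power_add power_mult[symmetric] mult_ac)
  also have "cis \<theta> ^ (2 * length P + 4 * j + m) * cnj (cis \<theta>) ^ (2 * length Q + 4 * k + n) =
      cis (of_int (charge P Q j k m n) * \<theta>)"
    unfolding cis_cnj[symmetric] Complex.DeMoivre cis_mult charge_def
    by (simp add: cis_cnj Complex.DeMoivre cis_mult algebra_simps)
  finally show ?thesis .
qed

lemma sum_roots_of_unity:
  fixes c :: int and N :: nat
  assumes "c \<noteq> 0" "\<bar>c\<bar> < int N"
  shows "(\<Sum>k<N. cis (of_int c * (2 * pi * real k / real N))) = 0"
proof -
  define z where "z = cis (of_int c * (2 * pi / real N))"
  have N: "N > 0" using assms by auto
  have "cis (of_int c * (2 * pi * real k / real N)) = z ^ k" for k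
    by (simp add: z_def Complex.DeMoivre field_simps)
  then have "(\<Sum>k<N. cis (of_int c * (2 * pi * real k / real N))) = (\<Sum>k<N. z ^ k)" by simp
  moreover have "z ^ N = 1"
    using N cis_multiple_2pi[of "of_int c"] by (simp add: z_def Complex.DeMoivre mult_ac)
  moreover have "z \<noteq> 1"
  proof
    assume "z = 1"
    then have "cos (of_int c * (2 * pi / real N)) = 1"
      by (simp add: z_def complex_eq_iff)
    then obtain x :: int where "of_int c * (2 * pi / real N) = of_int x * 2 * pi"
      by (auto simp: cos_one_2pi_int)
    then have "real_of_int c = of_int x * real N"
      using N by (simp add: field_simps)
    then have "c = x * int N"
      by (metis of_int_eq_iff of_int_mult of_int_of_nat_eq)
    with assms show False
      by (simp add: abs_mult)
  qed
  ultimately show ?thesis by (simp add: geometric_sum)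
qed

text \<open>The span of all monomials over the algebra of the \<open>SO(2)\<close> generators. Coefficients from that
  algebra take care of the \<open>\<xi>\<^sub>i\<close> and \<open>\<lambda>\<^sub>k\<close>, so that every polynomial belongs to it.\<close>

inductive_set mixed :: "(pt \<Rightarrow> complex) set" where
  scaled: "f \<in> SO2_complex \<Longrightarrow> (\<lambda>v. f v * power_product P Q j k m n v) \<in> mixed"
| add: "F \<in> mixed \<Longrightarrow> G \<in> mixed \<Longrightarrow> (\<lambda>v. F v + G v) \<in> mixed"

lemma mixed_mult:
  assumes "F \<in> mixed" "G \<in> mixed" shows "(\<lambda>v. F v * G v) \<in> mixed"
  using assms(1)
proof induction
  case (scaled f P Q j k m n)
  from assms(2) show ?case
  proof induction
    case (scaled g P' Q' j' k' m' n')
    have "(\<lambda>v. f v * g v * power_product (P @ P') (Q @ Q') (j + j') (k + k') (m + m') (n + n') v) \<in> mixed"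
      by (intro mixed.scaled complexified_mult scaled \<open>f \<in> SO2_complex\<close>)
    then show ?case by (simp add: power_product_def power_add mult_ac)
  next
    case (add G H)
    then show ?case by (simp add: distrib_left mixed.add)
  qed
next
  case (add F H)
  then show ?case by (simp add: distrib_right mixed.add)
qed

lemma mixed_SO2_complex: "F \<in> SO2_complex \<Longrightarrow> F \<in> mixed"
  using mixed.scaled[of F "[]" "[]" 0 0 0 0] by (simp add: power_product_def)

lemma mixed_power_product: "power_product P Q j k m n \<in> mixed"
  using mixed.scaled[OF complexified_const[of 1]] by simp

lemma mixed_cmult: "F \<in> mixed \<Longrightarrow> (\<lambda>v. c * F v) \<in> mixed"
  by (rule mixed_mult[OF mixed_SO2_complex[OF complexified_const]])

lemma mixed_Re_Im:
  assumes "F \<in> mixed" "(\<lambda>v. cnj (F v)) \<in> mixed"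
  shows "(\<lambda>v. complex_of_real (Re (F v))) \<in> mixed" "(\<lambda>v. complex_of_real (Im (F v))) \<in> mixed"
proof -
  have "complex_of_real (Re w) = 1/2 * w + 1/2 * cnj w" "complex_of_real (Im w) = -\<i>/2 * w + \<i>/2 * cnj w" for w
    by (simp_all add: complex_eq_iff)
  then show "(\<lambda>v. complex_of_real (Re (F v))) \<in> mixed" "(\<lambda>v. complex_of_real (Im (F v))) \<in> mixed"
    by (simp_all only:) (intro mixed.add mixed_cmult assms)+
qed

lemma mixed_coord: "(\<lambda>v. complex_of_real (Re (coord p v))) \<in> mixed" "(\<lambda>v. complex_of_real (Im (coord p v))) \<in> mixed"
  "(\<lambda>v. complex_of_real (Re (z4 v))) \<in> mixed" "(\<lambda>v. complex_of_real (Im (z4 v))) \<in> mixed"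
  "(\<lambda>v. complex_of_real (xi i v)) \<in> mixed" "(\<lambda>v. complex_of_real (lam i v)) \<in> mixed"
proof -
  have "coord p \<in> mixed \<and> (\<lambda>v. cnj (coord p v)) \<in> mixed"
  proof (cases "p = Lz")
    case True
    then show ?thesis using mixed_power_product[of "[]" "[]" 0 0 1 0] mixed_power_product[of "[]" "[]" 0 0 0 1]
      by (simp add: power_product_def[abs_def])
  next
    case False
    then show ?thesis using mixed_power_product[of "[p]" "[]" 0 0 0 0] mixed_power_product[of "[]" "[p]" 0 0 0 0]
      by (simp add: power_product_def[abs_def] vec2_def)
  qed
  then show "(\<lambda>v. complex_of_real (Re (coord p v))) \<in> mixed" "(\<lambda>v. complex_of_real (Im (coord p v))) \<in> mixed"
    using mixed_Re_Im by auto
  have "z4 \<in> mixed \<and> (\<lambda>v. cnj (z4 v)) \<in> mixed"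
    using mixed_power_product[of "[]" "[]" 1 0 0 0] mixed_power_product[of "[]" "[]" 0 1 0 0]
    by (simp add: power_product_def[abs_def])
  then show "(\<lambda>v. complex_of_real (Re (z4 v))) \<in> mixed" "(\<lambda>v. complex_of_real (Im (z4 v))) \<in> mixed"
    using mixed_Re_Im by auto
  show "(\<lambda>v. complex_of_real (xi i v)) \<in> mixed" "(\<lambda>v. complex_of_real (lam i v)) \<in> mixed"
    using SO2_complex_gen[of "Xi i"] SO2_complex_gen[of "Lam i"]
    by (auto intro!: mixed_SO2_complex simp: SO2_index_def common_index_def)
qed

text \<open>A device to treat the standard basis of the product space one factor at a time.\<close>

definition coordinates_mixed :: "(pt \<Rightarrow> 'a::euclidean_space) \<Rightarrow> bool" where
  "coordinates_mixed \<pi> \<longleftrightarrow> (\<forall>b\<in>Basis. (\<lambda>v. complex_of_real (\<pi> v \<bullet> b)) \<in> mixed)"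

lemma coordinates_mixed_prod:
  assumes "coordinates_mixed (\<lambda>v. fst (\<pi> v))" "coordinates_mixed (\<lambda>v. snd (\<pi> v))"
  shows "coordinates_mixed \<pi>"
  using assms by (auto simp: coordinates_mixed_def Basis_prod_def inner_prod_def)

lemma coordinates_mixed_complex:
  assumes "(\<lambda>v. complex_of_real (Re (\<pi> v))) \<in> mixed" "(\<lambda>v. complex_of_real (Im (\<pi> v))) \<in> mixed"
  shows "coordinates_mixed \<pi>"
  using assms by (simp add: coordinates_mixed_def Basis_complex_def)

lemma coordinates_mixed_vec:
  fixes \<pi> :: "pt \<Rightarrow> real^'n"
  assumes "\<And>i. (\<lambda>v. complex_of_real (\<pi> v $ i)) \<in> mixed"
  shows "coordinates_mixed \<pi>"
  using assms by (auto simp: coordinates_mixed_def Basis_vec_def inner_axis)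

lemma coordinates_mixed_id: "coordinates_mixed (\<lambda>v. v)"
proof -
  have c: "fst (fst v) $ i = xi i v" "fst (snd (fst v)) $ i = lam i v"
    "fst (snd (snd (fst v))) = coord La v" "fst (snd (snd (snd (fst v)))) = coord Lb v"
    "fst (snd (snd (snd (snd (fst v))))) = coord Lc v"
    "fst (snd (snd (snd (snd (snd (fst v)))))) = coord Ld v"
    "snd (snd (snd (snd (snd (snd (fst v)))))) = z4 v"
    "snd v $ 1 = Re (coord Lz v)" "snd v $ 2 = Im (coord Lz v)" for v :: pt and i
    by (cases v rule: z4.cases; simp)+
  have x: "(\<lambda>v :: pt. complex_of_real (snd v $ i)) \<in> mixed" for i
  proof -
    consider "i = 1" | "i = 2" using exhaust_2 by blast
    then show ?thesis by cases (simp_all only: c mixed_coord)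
  qed
  show ?thesis
    by (intro coordinates_mixed_prod coordinates_mixed_complex coordinates_mixed_vec)
       (simp_all only: c mixed_coord x)
qed

lemma mixed_linear:
  assumes "linear h" shows "(\<lambda>v. complex_of_real (h v)) \<in> mixed"
proof -
  have sum: "(\<lambda>v. \<Sum>b\<in>B. F b v) \<in> mixed" if "finite B" "\<And>b. b \<in> B \<Longrightarrow> F b \<in> mixed" for B :: "pt set" and F
    using that mixed_SO2_complex[OF complexified_const[of 0]]
    by (induction B rule: finite_induct) (auto intro: mixed.add)
  have h: "h v = (\<Sum>b\<in>Basis. h b * (v \<bullet> b))" for v
  proof -
    have "h v = h (\<Sum>b\<in>Basis. (v \<bullet> b) *\<^sub>R b)" by (simp only: euclidean_representation)
    then show ?thesis by (simp add: linear_sum[OF assms] linear_cmul[OF assms] mult.commute)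
  qed
  have "(\<lambda>v. complex_of_real (h v)) =
      (\<lambda>v. \<Sum>b\<in>Basis. complex_of_real (h b) * complex_of_real (v \<bullet> b))"
    by (rule ext, subst h) simp
  also have "\<dots> \<in> mixed"
    by (intro sum finite_Basis; rule mixed_cmult) (use coordinates_mixed_id in \<open>simp add: coordinates_mixed_def\<close>)
  finally show ?thesis .
qed

lemma mixed_polynomial:
  assumes "real_polynomial_function f" shows "(\<lambda>v. complex_of_real (f v)) \<in> mixed"
  using assms
proof induction
  case (linear f)
  then show ?case by (intro mixed_linear) (simp add: linear_conv_bounded_linear)
next
  case (const c)
  show ?case by (rule mixed_SO2_complex[OF complexified_const])
next
  case (add f g)
  then show ?case using mixed.add by simp
next
  case (mult f g)
  then show ?case using mixed_mult by simp
qed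

lemma SO2_complex_invariant: "F \<in> SO2_complex \<Longrightarrow> g \<in> SO2 \<Longrightarrow> F (pt_act g v) = F v"
proof -
  assume F: "F \<in> SO2_complex" and g: "g \<in> SO2"
  have "f (pt_act g v) = f v" if "f \<in> generated_algebra (gen ` SO2_index)" for f
    using generated_algebra_subset_Inv[of SO2 SO2_index, OF gen_invariant(1)] that g
    by (auto simp: Inv_def simp del: split_paired_All)
  from this[of "\<lambda>v. Re (F v)"] this[of "\<lambda>v. Im (F v)"] F show ?thesis
    by (simp add: complexified_def complex_eq_iff)
qed

text \<open>Averaging over the rotations of angle \<open>2 \<pi> k / N\<close> projects onto the part of charge \<open>0\<close>, once
  \<open>N\<close> exceeds all charges that occur.\<close>

lemma mixed_average:
  assumes "F \<in> mixed"
  shows "\<exists>F0\<in>SO2_complex. \<exists>N0. \<forall>N\<ge>N0. \<forall>v.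
    (\<Sum>k<N. F (pt_act (rot2 (2 * pi * real k / real N)) v)) = of_nat N * F0 v"
  using assms
proof induction
  case (scaled f P Q j k m n)
  have rot: "f (pt_act (rot2 \<theta>) v) * power_product P Q j k m n (pt_act (rot2 \<theta>) v) =
      cis (of_int (charge P Q j k m n) * \<theta>) * (f v * power_product P Q j k m n v)" for \<theta> v
    using SO2_complex_invariant[OF scaled rot2_SO2] by (simp add: power_product_rot2)
  show ?case
  proof (cases "charge P Q j k m n = 0")
    case True
    then have "(\<lambda>v. f v * power_product P Q j k m n v) \<in> SO2_complex"
      by (intro complexified_mult scaled power_product_balanced) (simp add: charge_def)
    with True show ?thesis
      unfolding rot by (intro bexI[of _ "\<lambda>v. f v * power_product P Q j k m n v"]) auto
  next
    case False
    show ?thesis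
      unfolding rot sum_distrib_right[symmetric]
      using sum_roots_of_unity[OF False]
      by (intro bexI[OF _ complexified_const[of 0]] exI[of _ "nat \<bar>charge P Q j k m n\<bar> + 1"]) auto
  qed
next
  case (add F G)
  then obtain F0 G0 M N where FG: "F0 \<in> SO2_complex" "G0 \<in> SO2_complex"
    "\<forall>n\<ge>M. \<forall>v. (\<Sum>k<n. F (pt_act (rot2 (2 * pi * real k / real n)) v)) = of_nat n * F0 v"
    "\<forall>n\<ge>N. \<forall>v. (\<Sum>k<n. G (pt_act (rot2 (2 * pi * real k / real n)) v)) = of_nat n * G0 v"
    by blast
  then show ?case
    by (intro bexI[OF _ complexified_add[OF FG(1,2)]] exI[of _ "max M N"])
       (auto simp: sum.distrib distrib_left)
qed

theorem Inv_SO2: "Inv SO2 pt_act = generated_algebra (gen ` SO2_index)"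
proof
  show "generated_algebra (gen ` SO2_index) \<subseteq> Inv SO2 pt_act"
    by (rule generated_algebra_subset_Inv[OF gen_invariant(1)])
  show "Inv SO2 pt_act \<subseteq> generated_algebra (gen ` SO2_index)"
  proof
    fix f assume f: "f \<in> Inv SO2 pt_act"
    then have "(\<lambda>v. complex_of_real (f v)) \<in> mixed"
      by (intro mixed_polynomial) (simp add: Inv_def)
    from mixed_average[OF this] obtain F0 N0 where F0: "F0 \<in> SO2_complex"
      and avg: "\<And>N v. N \<ge> N0 \<Longrightarrow>
        (\<Sum>k<N. complex_of_real (f (pt_act (rot2 (2 * pi * real k / real N)) v))) = of_nat N * F0 v"
      by blast
    have "f (pt_act (rot2 \<theta>) v) = f v" for \<theta> v
      using f rot2_SO2[of \<theta>] by (auto simp: Inv_def simp del: split_paired_All)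
    then have "complex_of_real (f v) = F0 v" for v
      using avg[of "Suc N0" v] by (simp del: of_nat_Suc)
    then have "f v = Re (F0 v)" for v by (metis Re_complex_of_real)
    then have "f = (\<lambda>v. Re (F0 v))" by blast
    with F0 show "f \<in> generated_algebra (gen ` SO2_index)" by (simp add: complexified_def)
  qed
qed


section \<open>Invariants of the full orthogonal group\<close>

abbreviation O2_algebra :: "(pt \<Rightarrow> real) set" where
  "O2_algebra \<equiv> generated_algebra (gen ` O2_index)"

lemma O2_algebra_gen: "j \<in> O2_index \<Longrightarrow> gen j \<in> O2_algebra"
  by (intro generated_algebra.gen) auto

lemma O2_algebra_xi_xi: "(\<lambda>v. xi i v * xi j v) \<in> O2_algebra"
proof -
  have "(i, j) \<in> xi_pairs \<or> (j, i) \<in> xi_pairs"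
    using exhaust_3[of i] exhaust_3[of j] by (auto simp: xi_pairs_def)
  then show ?thesis
    using O2_algebra_gen[of "XiXi i j"] O2_algebra_gen[of "XiXi j i"]
    by (auto simp: O2_index_def gen_fun mult.commute)
qed

text \<open>The reflection conjugates the monomials, so that their real parts are invariant while their
  imaginary parts change sign like the \<open>\<xi>\<^sub>i\<close> and become invariant after multiplication by one of
  them.\<close>

definition O2_covariant :: "(pt \<Rightarrow> complex) set" where
  "O2_covariant = {F. (\<lambda>v. Re (F v)) \<in> O2_algebra \<and> (\<forall>i. (\<lambda>v. xi i v * Im (F v)) \<in> O2_algebra)}"

lemma O2_covariant_cnj: "F \<in> O2_covariant \<Longrightarrow> (\<lambda>v. cnj (F v)) \<in> O2_covariant"
  by (simp add: O2_covariant_def generated_algebra_minus)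

lemma O2_covariant_scale:
  "f \<in> O2_algebra \<Longrightarrow> F \<in> O2_covariant \<Longrightarrow> (\<lambda>v. complex_of_real (f v) * F v) \<in> O2_covariant"
  using generated_algebra.mult by (fastforce simp: O2_covariant_def mult.left_commute)

lemma O2_covariant_of_real: "f \<in> O2_algebra \<Longrightarrow> (\<lambda>v. complex_of_real (f v)) \<in> O2_covariant"
  by (simp add: O2_covariant_def generated_algebra.const)

lemma O2_covariant_mon: "listed m \<Longrightarrow> mon m \<in> O2_covariant"
  using O2_algebra_gen[of "ReM m"] O2_algebra_gen[of "XiIm _ m"]
  by (auto simp: O2_covariant_def O2_index_def common_index_def gen_fun)

lemma O2_covariant_products:
  "(\<lambda>v. vec2 p v * cnj (vec2 q v)) \<in> O2_covariant"
  "(\<lambda>v. vec2 p v * vec2 q v * cnj (z4 v)) \<in> O2_covariant"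
proof -
  have common: "(\<lambda>v. complex_of_real (f v)) \<in> O2_covariant"
    if "f \<in> generated_algebra (gen ` common_index)" for f
    by (intro O2_covariant_of_real generated_algebra_mono[OF _ that])
       (auto simp: O2_index_def intro: generated_algebra.gen)
  show "(\<lambda>v. vec2 p v * cnj (vec2 q v)) \<in> O2_covariant"
    "(\<lambda>v. vec2 p v * vec2 q v * cnj (z4 v)) \<in> O2_covariant"
    by (intro quadratic_mem cubic_mem O2_covariant_mon O2_covariant_cnj common; assumption)+
qed

text \<open>Ten functions on which a rotation of angle \<open>\<theta>\<close> acts by \<open>exp (2 i \<theta>)\<close>. Every listed monomial is
  the product of one of them with the conjugate of another.\<close>

definition plane_vectors :: "(pt \<Rightarrow> complex) set" where
  "plane_vectors = range vec2 \<union> range (\<lambda>p v. z4 v * cnj (vec2 p v))"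

lemma O2_covariant_pairing:
  assumes "X \<in> plane_vectors" "Y \<in> plane_vectors"
  shows "(\<lambda>v. X v * cnj (Y v)) \<in> O2_covariant"
proof -
  have NormW: "gen NormW \<in> O2_algebra"
    by (intro O2_algebra_gen) (auto simp: O2_index_def common_index_def)
  have normW: "z4 v * cnj (z4 v) = complex_of_real (gen NormW v)" for v
    by (simp add: complex_eq_iff)
  have "(\<lambda>v. z4 v * cnj (vec2 p v) * cnj (z4 v * cnj (vec2 q v))) \<in> O2_covariant" for p q
  proof -
    have "(\<lambda>v. complex_of_real (gen NormW v) * (vec2 q v * cnj (vec2 p v))) =
        (\<lambda>v. z4 v * cnj (vec2 p v) * cnj (z4 v * cnj (vec2 q v)))"
      unfolding normW[symmetric] by (simp add: mult_ac)
    then show ?thesis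
      using O2_covariant_scale[OF NormW O2_covariant_products(1)[of q p]] by (simp only:)
  qed
  moreover have "(\<lambda>v. vec2 p v * cnj (z4 v * cnj (vec2 q v))) \<in> O2_covariant" for p q
    using O2_covariant_products(2)[of p q] by (simp add: mult_ac)
  moreover have "(\<lambda>v. z4 v * cnj (vec2 p v) * cnj (vec2 q v)) \<in> O2_covariant" for p q
    using O2_covariant_cnj[OF O2_covariant_products(2)[of p q]] by (simp add: mult_ac)
  ultimately show ?thesis
    using assms O2_covariant_products(1) by (auto simp: plane_vectors_def)
qed

text \<open>The product of two areas in the plane is a Gram determinant of inner products.\<close>

lemma bracket_product:
  "Im (x * cnj y) * Im (x' * cnj y') = Re (x * cnj x') * Re (y * cnj y') - Re (x * cnj y') * Re (y * cnj x')"
  by (simp add: algebra_simps)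

text \<open>The module over \<open>O2_algebra\<close> generated by the \<open>\<xi>\<^sub>i\<close> and the areas \<open>Im (X cnj Y)\<close>.\<close>

inductive_set odd_part :: "(pt \<Rightarrow> real) set" where
  xi: "b \<in> O2_algebra \<Longrightarrow> (\<lambda>v. b v * xi i v) \<in> odd_part"
| bracket: "b \<in> O2_algebra \<Longrightarrow> X \<in> plane_vectors \<Longrightarrow> Y \<in> plane_vectors \<Longrightarrow>
    (\<lambda>v. b v * Im (X v * cnj (Y v))) \<in> odd_part"
| add: "f \<in> odd_part \<Longrightarrow> g \<in> odd_part \<Longrightarrow> (\<lambda>v. f v + g v) \<in> odd_part"

lemma odd_part_scale: "f \<in> odd_part \<Longrightarrow> b \<in> O2_algebra \<Longrightarrow> (\<lambda>v. b v * f v) \<in> odd_part"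
proof (induction rule: odd_part.induct)
  case (xi c i)
  then show ?case using odd_part.xi[OF generated_algebra.mult[of b _ c]] by (simp add: mult.assoc)
next
  case (bracket c X Y)
  then show ?case using odd_part.bracket[OF generated_algebra.mult[of b _ c]] by (simp add: mult.assoc)
next
  case (add f g)
  then show ?case by (simp add: distrib_left odd_part.add)
qed

lemma odd_part_square:
  assumes "f \<in> odd_part" "g \<in> odd_part"
  shows "(\<lambda>v. f v * g v) \<in> O2_algebra"
proof -
  have combine: "(\<lambda>v. b v * s v * (c v * t v)) \<in> O2_algebra"
    if "b \<in> O2_algebra" "c \<in> O2_algebra" "(\<lambda>v. s v * t v) \<in> O2_algebra" for b c s t :: "pt \<Rightarrow> real"
    using generated_algebra.mult[OF generated_algebra.mult[OF that(1,2)] that(3)] by (simp add: mult_ac)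
  have xi_bracket: "(\<lambda>v. xi i v * Im (X v * cnj (Y v))) \<in> O2_algebra"
    "(\<lambda>v. Im (X v * cnj (Y v)) * xi i v) \<in> O2_algebra"
    if "X \<in> plane_vectors" "Y \<in> plane_vectors" for X Y i
    using O2_covariant_pairing[OF that] by (simp_all add: O2_covariant_def mult.commute)
  have bracket_bracket: "(\<lambda>v. Im (X v * cnj (Y v)) * Im (X' v * cnj (Y' v))) \<in> O2_algebra"
    if "X \<in> plane_vectors" "Y \<in> plane_vectors" "X' \<in> plane_vectors" "Y' \<in> plane_vectors" for X Y X' Y'
  proof -
    have "(\<lambda>v. Re (U v * cnj (W v))) \<in> O2_algebra" if "U \<in> plane_vectors" "W \<in> plane_vectors" for U W
      using O2_covariant_pairing[OF that] by (simp only: O2_covariant_def mem_Collect_eq)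
    with that show ?thesis
      unfolding bracket_product by (intro generated_algebra_diff generated_algebra.mult)
  qed
  from assms(1) show ?thesis
  proof induction
    case (xi b i)
    note b = \<open>b \<in> O2_algebra\<close>
    from assms(2) show ?case
    proof induction
      case (xi c j)
      then show ?case by (rule combine[OF b _ O2_algebra_xi_xi])
    next
      case (bracket c X Y)
      then show ?case by (intro combine[OF b _ xi_bracket(1)])
    qed (simp only: distrib_left generated_algebra.add)
  next
    case (bracket b X Y)
    note b = \<open>b \<in> O2_algebra\<close> and XY = \<open>X \<in> plane_vectors\<close> \<open>Y \<in> plane_vectors\<close>
    from assms(2) show ?case
    proof induction
      case (xi c j)
      then show ?case by (rule combine[OF b _ xi_bracket(2)[OF XY]])
    next
      case (bracket c X' Y')
      then show ?case by (intro combine[OF b _ bracket_bracket[OF XY]])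
    qed (simp only: distrib_left generated_algebra.add)
  qed (simp only: distrib_right generated_algebra.add)
qed

text \<open>The sums \<open>e + h\<close> contain the \<open>SO(2)\<close> generators, and they form an algebra because
  \<open>odd_part_square\<close> puts the product of two odd parts back into \<open>O2_algebra\<close>.\<close>

lemma even_odd_decomposition:
  assumes "f \<in> generated_algebra (gen ` SO2_index)"
  shows "\<exists>e\<in>O2_algebra. \<exists>h\<in>odd_part. f = (\<lambda>v. e v + h v)"
proof -
  have zero: "(\<lambda>_. 0) \<in> odd_part"
    using odd_part.xi[OF generated_algebra.const[of 0]] by simp
  have even: "\<exists>e\<in>O2_algebra. \<exists>h\<in>odd_part. f = (\<lambda>v. e v + h v)" if "f \<in> O2_algebra" for f
    using that by (intro bexI[OF _ that] bexI[OF _ zero]) simp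
  have odd: "\<exists>e\<in>O2_algebra. \<exists>h\<in>odd_part. f = (\<lambda>v. e v + h v)" if "f \<in> odd_part" for f
    using that by (intro bexI[OF _ generated_algebra.const[of 0]] bexI[OF _ that]) simp
  from assms show ?thesis
  proof induction
    case (const c)
    show ?case by (rule even[OF generated_algebra.const])
  next
    case (gen f)
    then consider j where "j \<in> common_index" "f = gen j" | i where "f = gen (Xi i)" | m where "f = gen (ImM m)"
      by (auto simp: SO2_index_def)
    then show ?case
    proof cases
      case 1
      then show ?thesis using O2_algebra_gen[of j] by (intro even) (simp add: O2_index_def)
    next
      case 2
      then show ?thesis
        using odd_part.xi[OF generated_algebra.const[of 1], of i] by (intro odd) (simp add: gen_fun)
    next
      case 3
      have "\<exists>X\<in>plane_vectors. \<exists>Y\<in>plane_vectors. mon m = (\<lambda>v. X v * cnj (Y v))"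
      proof (cases m)
        case (Quad p q)
        then show ?thesis by (auto simp: plane_vectors_def mon_fun)
      next
        case (Cubic p q)
        then show ?thesis
          by (intro bexI[of _ "vec2 p"] bexI[of _ "\<lambda>v. z4 v * cnj (vec2 q v)"])
             (auto simp: plane_vectors_def mon_fun)
      qed
      with 3 show ?thesis
        using odd_part.bracket[OF generated_algebra.const[of 1]] by (intro odd) (auto simp: gen_fun)
    qed
  next
    case (add f g)
    then obtain e h e' h' where "e \<in> O2_algebra" "h \<in> odd_part" "f = (\<lambda>v. e v + h v)"
      "e' \<in> O2_algebra" "h' \<in> odd_part" "g = (\<lambda>v. e' v + h' v)" by blast
    then show ?case
      by (intro bexI[of _ "\<lambda>v. e v + e' v"] bexI[of _ "\<lambda>v. h v + h' v"])
         (auto intro: generated_algebra.add odd_part.add)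
  next
    case (mult f g)
    then obtain e h e' h' where eh: "e \<in> O2_algebra" "h \<in> odd_part" "f = (\<lambda>v. e v + h v)"
      "e' \<in> O2_algebra" "h' \<in> odd_part" "g = (\<lambda>v. e' v + h' v)" by blast
    have "(\<lambda>v. e v * e' v + h v * h' v) \<in> O2_algebra"
      by (intro generated_algebra.add generated_algebra.mult odd_part_square eh)
    moreover have "(\<lambda>v. e v * h' v + e' v * h v) \<in> odd_part"
      by (intro odd_part.add odd_part_scale eh)
    ultimately show ?case
      unfolding eh by (intro bexI[of _ "\<lambda>v. e v * e' v + h v * h' v"] bexI[of _ "\<lambda>v. e v * h' v + e' v * h v"])
        (auto simp: algebra_simps)
  qed
qed

lemma refl2_O2: "refl2 \<in> O2"
  by (simp add: O2_def orthogonal_matrix refl2_def vec_eq_iff forall_2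
      matrix_matrix_mult_def transpose_def mat_def sum_2)

lemma refl2_coords:
  "twist refl2 w = cnj w" "unit_of refl2 = 1" "det refl2 = -1"
  by (simp_all add: twist_def unit_of_def refl2_def det_2 complex_eq_iff)

lemma odd_part_refl2: "h \<in> odd_part \<Longrightarrow> h (pt_act refl2 v) = - h v"
proof (induction rule: odd_part.induct)
  case (xi b i)
  then have "b (pt_act refl2 v) = b v"
    using generated_algebra_subset_Inv[of O2 O2_index, OF gen_invariant(2)] refl2_O2
    by (auto simp: Inv_def simp del: split_paired_All)
  then show ?case by (simp add: pt_act_coords refl2_O2 refl2_coords)
next
  case (bracket b X Y)
  then have "b (pt_act refl2 v) = b v"
    using generated_algebra_subset_Inv[of O2 O2_index, OF gen_invariant(2)] refl2_O2
    by (auto simp: Inv_def simp del: split_paired_All)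
  moreover have "X (pt_act refl2 v) = cnj (X v)" if "X \<in> plane_vectors" for X
    using that by (auto simp: plane_vectors_def vec2_pt_act pt_act_coords refl2_O2 refl2_coords)
  from this[OF bracket(2)] this[OF bracket(3)]
  have "Im (X (pt_act refl2 v) * cnj (Y (pt_act refl2 v))) = - Im (X v * cnj (Y v))" by simp
  ultimately show ?case by (simp only: mult_minus_right)
qed simp

theorem Inv_O2: "Inv O2 pt_act = generated_algebra (gen ` O2_index)"
proof
  show "generated_algebra (gen ` O2_index) \<subseteq> Inv O2 pt_act"
    by (rule generated_algebra_subset_Inv[OF gen_invariant(2)])
  show "Inv O2 pt_act \<subseteq> generated_algebra (gen ` O2_index)"
  proof
    fix f assume f: "f \<in> Inv O2 pt_act"
    then have "f \<in> Inv SO2 pt_act" by (auto simp: Inv_def SO2_eq)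
    then obtain e h where eh: "e \<in> O2_algebra" "h \<in> odd_part" "f = (\<lambda>v. e v + h v)"
      using even_odd_decomposition[of f] by (auto simp: Inv_SO2)
    have inv: "f (pt_act refl2 v) = f v" if "f \<in> Inv O2 pt_act" for f v
      using that refl2_O2 by (auto simp: Inv_def simp del: split_paired_All)
    have "e \<in> Inv O2 pt_act"
      using eh(1) generated_algebra_subset_Inv[of O2 O2_index, OF gen_invariant(2)] by blast
    then have "h v = 0" for v
      using inv[OF f, of v] inv[of e v] odd_part_refl2[OF eh(2), of v] by (simp add: eh(3))
    with eh show "f \<in> generated_algebra (gen ` O2_index)" by simp
  qed
qed


section \<open>Passing to tensors\<close>

lemma minimal_integrity_basis_if_irreducible:
  assumes "finite J" "\<And>k. k \<in> J \<Longrightarrow> homogeneous_function (g k)" "generated_algebra (g ` J) = A"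
    and "\<And>k. k \<in> J \<Longrightarrow> g k \<notin> generated_algebra (g ` (J - {k}))"
  shows "minimal_integrity_basis A (g ` J)"
  using assms generated_algebra_psubset_if_irreducible[OF assms(4)]
  by (auto simp: minimal_integrity_basis_def integrity_basis_def)

text \<open>A decomposition \<open>\<Phi>\<close> and its inverse are linear and equivariant, hence composition with them
  preserves polynomials and invariance.\<close>

lemma Cov_harmonic_decomposition:
  assumes \<Phi>: "harmonic_decomposition \<Phi>" and G: "G \<subseteq> O2"
  shows "Cov G tensor_act = (\<lambda>f. f \<circ> map_prod \<Phi> id) ` Inv G pt_act"
proof -
  have lin: "linear \<Phi>" and bij: "bij \<Phi>"
    and equiv: "\<And>g T. g \<in> O2 \<Longrightarrow> \<Phi> (tensor_act g T) = harm4_act g (\<Phi> T)"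
    using \<Phi> by (auto simp: harmonic_decomposition_def)
  have lin_inv: "linear (inv \<Phi>)"
  proof (rule linearI)
    have inv: "\<Phi> (inv \<Phi> h) = h" "inv \<Phi> (\<Phi> T) = T" for h T
      using bij by (simp_all add: bij_is_surj surj_f_inv_f bij_is_inj)
    show "inv \<Phi> (h + h') = inv \<Phi> h + inv \<Phi> h'" for h h'
      using inv(2)[of "inv \<Phi> h + inv \<Phi> h'"] by (simp add: linear_add[OF lin] inv(1))
    show "inv \<Phi> (r *\<^sub>R h) = r *\<^sub>R inv \<Phi> h" for r h
      using inv(2)[of "r *\<^sub>R inv \<Phi> h"] by (simp add: linear_cmul[OF lin] inv(1))
  qed
  have poly: "real_polynomial_function (f \<circ> map_prod A id)"
    if "real_polynomial_function f" "linear A"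
    for f :: "'b::euclidean_space \<times> (real^2) \<Rightarrow> real" and A :: "'a::euclidean_space \<Rightarrow> 'b"
  proof (rule real_polynomial_function_compose[OF polynomial_function_bounded_linear that(1)])
    show "bounded_linear (map_prod A (id :: real^2 \<Rightarrow> real^2))"
      using that(2) by (auto simp: linear_conv_bounded_linear[symmetric] linear_iff)
  qed
  have cov: "Cov G tensor_act =
      {F. real_polynomial_function F \<and> (\<forall>g\<in>G. \<forall>T x. F (tensor_act g T, g *v x) = F (T, x))}"
    by (auto simp: Cov_def Inv_def)
  have inv_pt: "Inv G pt_act =
      {f. real_polynomial_function f \<and> (\<forall>g\<in>G. \<forall>h x. f (harm4_act g h, g *v x) = f (h, x))}"
    by (auto simp: pt_act_def Inv_def)
  show ?thesis
  proof (intro equalityI subsetI)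
    fix F assume F: "F \<in> Cov G tensor_act"
    have "F (inv \<Phi> (harm4_act g h), g *v x) = F (inv \<Phi> h, x)" if "g \<in> G" for g h x
    proof -
      have "inv \<Phi> (harm4_act g h) = tensor_act g (inv \<Phi> h)"
        using equiv[of g "inv \<Phi> h"] that G bij by (metis bij_inv_eq_iff subsetD)
      with F that show ?thesis by (auto simp: cov)
    qed
    with F have "F \<circ> map_prod (inv \<Phi>) id \<in> Inv G pt_act"
      using poly[OF _ lin_inv, of F] by (auto simp: inv_pt cov)
    moreover have "F = (F \<circ> map_prod (inv \<Phi>) id) \<circ> map_prod \<Phi> id"
      using bij by (auto simp: fun_eq_iff bij_is_inj)
    ultimately show "F \<in> (\<lambda>f. f \<circ> map_prod \<Phi> id) ` Inv G pt_act" by blast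
  next
    fix F assume "F \<in> (\<lambda>f. f \<circ> map_prod \<Phi> id) ` Inv G pt_act"
    then obtain f where "F = f \<circ> map_prod \<Phi> id" "f \<in> Inv G pt_act" by blast
    then show "F \<in> Cov G tensor_act"
      using poly[OF _ lin, of f] equiv G by (auto simp: inv_pt cov subset_iff simp del: split_paired_All)
  qed
qed

text \<open>Irreducibility survives the change of coordinates because \<open>\<Phi>\<close> is surjective. It makes the family
  injective on \<open>J\<close>, so that counting generators is counting names.\<close>

lemma minimal_basis_of_tensor_covariants:
  fixes \<Phi> :: "tensor4 \<Rightarrow> harm4"
  assumes \<Phi>: "harmonic_decomposition \<Phi>" and G: "G \<subseteq> O2" and "finite J"
    and Inv: "Inv G pt_act = generated_algebra (gen ` J)"
    and irred: "\<And>k. k \<in> J \<Longrightarrow> gen k \<notin> generated_algebra (gen ` (J - {k}))"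
  shows "minimal_integrity_basis (Cov G tensor_act) (in_coords \<Phi> (gen ` J))"
    and "card (in_coords \<Phi> (gen ` J)) = card J"
    and "card {f \<in> in_coords \<Phi> (gen ` J). cov_order f = 0} = card {j \<in> J. order_of j = 0}"
proof -
  let ?\<Psi> = "map_prod \<Phi> (id :: real^2 \<Rightarrow> real^2)"
  define g where "g j = gen j \<circ> ?\<Psi>" for j
  have lin: "linear \<Phi>" and surj: "surj ?\<Psi>"
    using \<Phi> by (auto simp: harmonic_decomposition_def bij_def intro!: map_prod_surj)
  have coords: "in_coords \<Phi> (gen ` J) = g ` J"
    by (auto simp: in_coords_def g_def image_image fun_eq_iff intro!: image_cong)
  have image: "generated_algebra (g ` K) = (\<lambda>f. f \<circ> ?\<Psi>) ` generated_algebra (gen ` K)" for K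
    using generated_algebra_image_comp[of ?\<Psi> "gen ` K"] by (simp add: g_def[abs_def] image_image)
  have cancel: "f = f'" if "f \<circ> ?\<Psi> = f' \<circ> ?\<Psi>" for f f' :: "pt \<Rightarrow> real"
  proof
    fix v
    obtain u where "v = ?\<Psi> u" using surj by (rule surjE)
    with fun_cong[OF that, of u] show "f v = f' v" by simp
  qed
  have irred': "g k \<notin> generated_algebra (g ` (J - {k}))" if "k \<in> J" for k
  proof
    assume "g k \<in> generated_algebra (g ` (J - {k}))"
    then obtain f where "f \<in> generated_algebra (gen ` (J - {k}))" "gen k \<circ> ?\<Psi> = f \<circ> ?\<Psi>"
      unfolding image by (auto simp: g_def)
    from this(1) irred[OF that] cancel[OF this(2)] show False by simp
  qed
  have homogeneous: "homogeneous_function (g j)" for j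
  proof -
    have "?\<Psi> (t *\<^sub>R v) = t *\<^sub>R ?\<Psi> v" for t v
      using lin by (cases v) (simp add: linear_cmul)
    then have "g j (t *\<^sub>R v) = t ^ weight (\<lambda>_. 1) 1 (\<lambda>_. 1) 1 j * g j v" for t v
      using gen_wscale[of j "\<lambda>_. 1" 1 "\<lambda>_. 1" 1 t "?\<Psi> v"] by (simp only: wscale_uniform g_def o_apply)
    then show ?thesis unfolding homogeneous_function_def by blast
  qed
  have inj: "inj_on g J"
    using irred' by (rule inj_on_if_irreducible)
  have order: "cov_order (g j) = order_of j" if "j \<in> J" for j
  proof (rule cov_order_eq)
    show "g j (T, t *\<^sub>R x) = t ^ order_of j * g j (T, x)" for T t x
      using gen_wscale[of j "\<lambda>_. 0" 0 "\<lambda>p. if p = Lz then 1 else 0" 0 t "(\<Phi> T, x)"]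
      by (simp only: wscale_x g_def o_apply map_prod_simp id_apply)
    show "g j \<noteq> (\<lambda>_. 0)"
    proof
      assume "g j = (\<lambda>_. 0)"
      with irred'[OF that] generated_algebra.const[of 0 "g ` (J - {j})"] show False by simp
    qed
  qed
  show "minimal_integrity_basis (Cov G tensor_act) (in_coords \<Phi> (gen ` J))"
    unfolding coords
    by (intro minimal_integrity_basis_if_irreducible \<open>finite J\<close> homogeneous irred')
       (simp_all add: image Cov_harmonic_decomposition[OF \<Phi> G] Inv)
  show "card (in_coords \<Phi> (gen ` J)) = card J"
    unfolding coords using inj by (rule card_image)
  have order0: "{f \<in> g ` J. cov_order f = 0} = g ` {j \<in> J. order_of j = 0}"
    using order by auto
  have "inj_on g {j \<in> J. order_of j = 0}"
    using inj by (rule inj_on_subset) blast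
  then show "card {f \<in> in_coords \<Phi> (gen ` J). cov_order f = 0} = card {j \<in> J. order_of j = 0}"
    unfolding coords order0 by (rule card_image)
qed

theorem theorem8p5:
  fixes \<Phi> :: "tensor4 \<Rightarrow> harm4"
  assumes "harmonic_decomposition \<Phi>"
  shows "(minimal_integrity_basis (Cov SO2 tensor_act) (in_coords \<Phi> SO2_generators) \<and>
          card (in_coords \<Phi> SO2_generators) = 62 \<and>
          card {f \<in> in_coords \<Phi> SO2_generators. cov_order f = 0} = 43) \<and>
         (minimal_integrity_basis (Cov O2 tensor_act) (in_coords \<Phi> O2_generators) \<and>
          card (in_coords \<Phi> O2_generators) = 115 \<and>
          card {f \<in> in_coords \<Phi> O2_generators. cov_order f = 0} = 78)"
proof -
  have "SO2 \<subseteq> O2" by (auto simp: SO2_eq)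
  note SO2 = minimal_basis_of_tensor_covariants[OF assms this card_SO2_index(1) Inv_SO2 SO2_irreducible]
  note O2 = minimal_basis_of_tensor_covariants[OF assms subset_refl card_O2_index(1) Inv_O2 O2_irreducible]
  show ?thesis
    unfolding SO2_generators_eq O2_generators_eq
    using SO2 O2 by (simp only: card_SO2_index card_O2_index)
qed

end
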